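(* Let $\mathcal{C}$ be an extension-closed pseudovariety of finite groups. Let $F_1,F_2$ be $\mathcal{C}$-hereditarily conjugacy separable groups with cyclic centralizers, let $G\leqslant F_1\times F_2$ be a subdirect product and let $N_1:=G\cap F_1$. If $F_1/N_1$ is cyclic subgroup $\mathcal{C}$-separable, then $G$ is $\mathcal{C}$-conjugacy separable.
   Context: A pseudovariety of groups is a class of groups closed under isomorphisms, subgroups, direct products of two members, and quotients; it is a pseudovariety of finite groups if all its members are finite, and extension-closed if any group $A$ with a normal subgroup $N$ such that $N\in\mathcal{C}$ and $A/N\in\mathcal{C}$ belongs to $\mathcal{C}$. The pro-$\mathcal{C}$ topology on a group $A$ has as basic open sets the cosets of the normal subgroups $N\lhd A$ with $A/N\in\mathcal{C}$. A group $A$ is $\mathcal{C}$-conjugacy separable if for any two non-conjugate elements $x,y\in A$ there are $M\in\mathcal{C}$ and a homomorphism $\varphi:A\to M$ such that $\varphi(x)$ and $\varphi(y)$ are not conjugate in $M$. $A$ is $\mathcal{C}$-hereditarily conjugacy separable if every subgroup of $A$ which is open in the pro-$\mathcal{C}$ topology on $A$ is $\mathcal{C}$-conjugacy separable. $A$ is cyclic subgroup $\mathcal{C}$-separable if every cyclic subgroup of $A$ is closed in the pro-$\mathcal{C}$ topology on $A$. $A$ has cyclic centralizers if the centralizer of every non-trivial element of $A$ is cyclic. In $F_1\times F_2$ one identifies $F_1$ with $F_1\times\{1\}$ and $F_2$ with $\{1\}\times F_2$. A subgroup $G\leqslant F_1\times F_2$ is a subdirect product if both coordinate projections map $G$ onto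 $F_1$ and $F_2$ respectively; then $G\cap F_i\lhd F_i$. *)

theory Defs
  imports "HOL-Algebra.Algebra" "HOL-Analysis.Function_Topology"
begin

text \<open>
  A class of finite groups is represented by its members with carrier in \<open>nat\<close>. Every finite
  group has such a copy, so an isomorphism-closed class of finite groups is determined by them;
  a group over an arbitrary type belongs to the class if it is isomorphic to one of them.
\<close>

type_synonym group_class = "nat monoid set"

definition belongs_to :: "group_class \<Rightarrow> ('a, 'b) monoid_scheme \<Rightarrow> bool" where
  "belongs_to C A \<longleftrightarrow> group A \<and> (\<exists>M\<in>C. A \<cong> M)"

definition pseudovariety_of_finite_groups :: "group_class \<Rightarrow> bool" where
  "pseudovariety_of_finite_groups C \<longleftrightarrow>
     (\<forall>M\<in>C. group M \<and> finite (carrier M)) \<and>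
     (\<forall>M\<in>C. \<forall>L :: nat monoid. group L \<longrightarrow> M \<cong> L \<longrightarrow> L \<in> C) \<and>
     (\<forall>M\<in>C. \<forall>H. subgroup H M \<longrightarrow> M\<lparr>carrier := H\<rparr> \<in> C) \<and>
     (\<forall>M\<in>C. \<forall>L\<in>C. belongs_to C (M \<times>\<times> L)) \<and>
     (\<forall>M\<in>C. \<forall>N. N \<lhd> M \<longrightarrow> belongs_to C (M Mod N))"

text \<open>
  Restricting \<open>A\<close> to groups over \<open>nat\<close> loses nothing: an extension of a finite group by a
  finite group is finite.
\<close>

definition extension_closed :: "group_class \<Rightarrow> bool" where
  "extension_closed C \<longleftrightarrow>
     (\<forall>(A :: nat monoid) N. N \<lhd> A \<longrightarrow> belongs_to C (A\<lparr>carrier := N\<rparr>) \<longrightarrow>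
        belongs_to C (A Mod N) \<longrightarrow> A \<in> C)"

text \<open>
  When \<open>C\<close> is a nonempty pseudovariety, the cosets below include the whole group and the
  nonempty intersections of two of them are again such cosets, so they form a base. The explicit
  \<open>carrier A\<close> only matters for empty \<open>C\<close>, where it makes this a topology on all of \<open>A\<close>.
\<close>

definition pro_topology :: "group_class \<Rightarrow> ('a, 'b) monoid_scheme \<Rightarrow> 'a topology" where
  "pro_topology C A = topology_generated_by
     (insert (carrier A)
       {N #>\<^bsub>A\<^esub> a | N a. N \<lhd> A \<and> belongs_to C (A Mod N) \<and> a \<in> carrier A})"

definition conjugate_in :: "('a, 'b) monoid_scheme \<Rightarrow> 'a \<Rightarrow> 'a \<Rightarrow> bool" where
  "conjugate_in A x y \<longleftrightarrow> (\<exists>g\<in>carrier A. y = g \<otimes>\<^bsub>A\<^esub> x \<otimes>\<^bsub>A\<^esub> inv\<^bsub>A\<^esub> g)"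

definition conjugacy_separable :: "group_class \<Rightarrow> ('a, 'b) monoid_scheme \<Rightarrow> bool" where
  "conjugacy_separable C A \<longleftrightarrow>
     (\<forall>x\<in>carrier A. \<forall>y\<in>carrier A. \<not> conjugate_in A x y \<longrightarrow>
        (\<exists>M\<in>C. \<exists>\<phi>\<in>hom A M. \<not> conjugate_in M (\<phi> x) (\<phi> y)))"

definition hereditarily_conjugacy_separable ::
    "group_class \<Rightarrow> ('a, 'b) monoid_scheme \<Rightarrow> bool" where
  "hereditarily_conjugacy_separable C A \<longleftrightarrow>
     (\<forall>H. subgroup H A \<longrightarrow> openin (pro_topology C A) H \<longrightarrow>
        conjugacy_separable C (A\<lparr>carrier := H\<rparr>))"

definition cyclic_subgroup_separable :: "group_class \<Rightarrow> ('a, 'b) monoid_scheme \<Rightarrow> bool" where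
  "cyclic_subgroup_separable C A \<longleftrightarrow>
     (\<forall>H. subgroup H A \<longrightarrow> cyclic_group (A\<lparr>carrier := H\<rparr>) \<longrightarrow> closedin (pro_topology C A) H)"

definition centralizer :: "('a, 'b) monoid_scheme \<Rightarrow> 'a \<Rightarrow> 'a set" where
  "centralizer A x = {g \<in> carrier A. g \<otimes>\<^bsub>A\<^esub> x = x \<otimes>\<^bsub>A\<^esub> g}"

definition cyclic_centralizers :: "('a, 'b) monoid_scheme \<Rightarrow> bool" where
  "cyclic_centralizers A \<longleftrightarrow>
     (\<forall>x\<in>carrier A. x \<noteq> \<one>\<^bsub>A\<^esub> \<longrightarrow> cyclic_group (A\<lparr>carrier := centralizer A x\<rparr>))"

definition subdirect_product ::
    "('a \<times> 'b) set \<Rightarrow> ('a, 'c) monoid_scheme \<Rightarrow> ('b, 'd) monoid_scheme \<Rightarrow> bool" where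
  "subdirect_product G F1 F2 \<longleftrightarrow>
     subgroup G (F1 \<times>\<times> F2) \<and> fst ` G = carrier F1 \<and> snd ` G = carrier F2"

end

theory Submission
  imports Defs
begin

text \<open>
  Let \<open>\<pi>\<^sub>1\<close>, \<open>\<pi>\<^sub>2\<close> be the maps from \<open>F1\<close> and \<open>F2\<close> to \<open>Q = F1 / N1\<close>, so that \<open>G\<close> consists of the pairs
  with equal images. After conjugating in \<open>G\<close>, two elements of \<open>G\<close> whose coordinates are conjugate have
  the form \<open>(x1, x2)\<close> and \<open>(x1, y2)\<close>, where \<open>f\<close> conjugates \<open>x2\<close> to \<open>y2\<close>; they are conjugate in \<open>G\<close> iff
  \<open>\<pi>\<^sub>2(f)\<close> lies in \<open>\<pi>\<^sub>1(Z(x1)) \<pi>\<^sub>2(Z(x2))\<close>, where \<open>Z\<close> denotes centralizers. For nontrivial \<open>x1\<close> and \<open>x2\<close>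
  the cyclic group \<open>Z(xi)\<close> is a finite union of cosets of \<open>\<langle>xi\<rangle>\<close>, so with \<open>q = \<pi>\<^sub>1(x1) = \<pi>\<^sub>2(x2)\<close> this
  product is a finite union of cosets of \<open>\<langle>q\<rangle>\<close>, and hence closed. An open normal subgroup of \<open>Q\<close> that
  separates \<open>\<pi>\<^sub>2(f)\<close> from it pulls back to \<open>K1\<close> and \<open>K2\<close>. Hereditary conjugacy separability yields
  open normal subgroups \<open>L1\<close>, \<open>L2\<close> such that everything commuting with \<open>xi\<close> modulo \<open>Li\<close> lies in
  \<open>Z(xi) Ki\<close>, and then the two elements are not conjugate in the image of \<open>G\<close> in \<open>F1 / L1 \<times> F2 / L2\<close>.
\<close>

section \<open>Open normal subgroups of the pro-topology\<close>

text \<open>For a nonempty pseudovariety these are exactly the normal subgroups that are open in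
  \<open>pro_topology C A\<close>, because \<open>C\<close> is closed under quotients. Almost all of
  the proof works with them instead of with open sets.\<close>

definition open_normal :: "group_class \<Rightarrow> ('a, 'b) monoid_scheme \<Rightarrow> 'a set \<Rightarrow> bool" where
  "open_normal C A N \<longleftrightarrow> N \<lhd> A \<and> belongs_to C (A Mod N)"

lemma open_normal_normal: "open_normal C A N \<Longrightarrow> N \<lhd> A"
  by (simp add: open_normal_def)

lemma open_normal_subgroup: "open_normal C A N \<Longrightarrow> subgroup N A"
  by (simp add: open_normal_def normal_imp_subgroup)

lemma (in group) r_coset_eq_subgroup_iff:
  assumes "subgroup N G" "x \<in> carrier G"
  shows "N #> x = N \<longleftrightarrow> x \<in> N"
  using assms by (metis coset_join1 coset_join2)

lemma (in group) mult_inv_cancel_left: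
  assumes "x \<in> carrier G" "y \<in> carrier G"
  shows "x \<otimes> (inv x \<otimes> y) = y" "inv x \<otimes> (x \<otimes> y) = y"
  using assms by (simp_all flip: m_assoc)

text \<open>These rules bring a product to right-associated form and cancel adjacent inverse pairs,
  so that \<open>simp\<close> can settle identities between group words.\<close>

lemmas (in group) word_simps = m_assoc inv_mult_group mult_inv_cancel_left

lemma (in normal) kernel_r_coset: "kernel G (G Mod H) ((#>) H) = H"
  using r_coset_eq_subgroup_iff[OF is_subgroup] mem_carrier unfolding kernel_def one_FactGroup by blast

section \<open>Closure properties of the class and of its open normal subgroups\<close>

context
  fixes C :: group_class
  assumes pseudovariety: "pseudovariety_of_finite_groups C"
begin

lemma member_group: "M \<in> C \<Longrightarrow> group M"
  using pseudovariety unfolding pseudovariety_of_finite_groups_def by blast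

lemma member_finite: "M \<in> C \<Longrightarrow> finite (carrier M)"
  using pseudovariety unfolding pseudovariety_of_finite_groups_def by blast

lemma member_subgroup: "M \<in> C \<Longrightarrow> subgroup H M \<Longrightarrow> M\<lparr>carrier := H\<rparr> \<in> C"
  using pseudovariety unfolding pseudovariety_of_finite_groups_def by blast

lemma member_DirProd: "M \<in> C \<Longrightarrow> L \<in> C \<Longrightarrow> belongs_to C (M \<times>\<times> L)"
  using pseudovariety unfolding pseudovariety_of_finite_groups_def by blast

lemma belongs_to_member: "M \<in> C \<Longrightarrow> belongs_to C M"
  using member_group iso_refl unfolding belongs_to_def by blast

lemma belongs_to_finite:
  assumes "belongs_to C A" shows "finite (carrier A)"
proof -
  obtain M f where "M \<in> C" "f \<in> iso A M"
    using assms by (auto simp: belongs_to_def is_iso_def)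
  with member_finite show ?thesis
    by (auto simp: iso_def dest: bij_betw_finite)
qed

text \<open>A maps isomorphically onto a subgroup of a member of \<open>C\<close>, and
  \<open>C\<close> contains the subgroups of its members.\<close>

lemma belongs_to_embed:
  assumes A: "group A" and f: "f \<in> hom A B" "inj_on f (carrier A)" and B: "belongs_to C B"
  shows "belongs_to C A"
proof -
  obtain M g where M: "M \<in> C" and g: "g \<in> iso B M"
    using B by (auto simp: belongs_to_def is_iso_def)
  let ?h = "g \<circ> f"
  have h: "?h \<in> hom A M"
    using f g by (auto simp: iso_def intro: Group.hom_compose)
  interpret h: group_hom A M ?h
    using A h member_group[OF M] by (simp add: group_hom_def group_hom_axioms_def)
  let ?H = "?h ` carrier A"
  have "inj_on g (f ` carrier A)"
    using f g by (auto simp: iso_def bij_betw_def hom_def intro: inj_on_subset)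
  then have "inj_on ?h (carrier A)"
    using f by (simp add: comp_inj_on)
  then have "?h \<in> iso A (M\<lparr>carrier := ?H\<rparr>)"
    using h by (auto simp: iso_def hom_def bij_betw_def)
  moreover have "M\<lparr>carrier := ?H\<rparr> \<in> C"
    using M h.img_is_subgroup by (rule member_subgroup)
  ultimately show ?thesis
    using A by (auto simp: belongs_to_def is_iso_def)
qed

lemma belongs_to_DirProd:
  assumes "belongs_to C A" "belongs_to C B"
  shows "belongs_to C (A \<times>\<times> B)"
proof -
  obtain M f where M: "M \<in> C" and f: "f \<in> iso A M"
    using assms(1) by (auto simp: belongs_to_def is_iso_def)
  obtain L g where L: "L \<in> C" and g: "g \<in> iso B L"
    using assms(2) by (auto simp: belongs_to_def is_iso_def)
  have fg: "(\<lambda>(x, y). (f x, g y)) \<in> iso (A \<times>\<times> B) (M \<times>\<times> L)"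
    using f g assms by (intro group.DirProd_iso_set_trans) (auto simp: belongs_to_def)
  have "belongs_to C (M \<times>\<times> L)"
    using M L by (rule member_DirProd)
  moreover have "group (A \<times>\<times> B)"
    using assms by (auto simp: belongs_to_def intro: DirProd_group)
  ultimately show ?thesis
    using fg by (auto simp: iso_def bij_betw_def intro: belongs_to_embed)
qed

text \<open>By the first isomorphism theorem \<open>A Mod kernel A B f\<close> embeds in
  \<open>B\<close>. Open normal subgroups are mostly produced by exhibiting them as kernels in this
  way.\<close>

lemma open_normal_kernel:
  assumes "group A" "f \<in> hom A B" "belongs_to C B"
  shows "open_normal C A (kernel A B f)"
proof -
  interpret f: group_hom A B f
    using assms by (auto simp: group_hom_def group_hom_axioms_def belongs_to_def)
  show ?thesis
    using belongs_to_embed[OF normal.factorgroup_is_group[OF f.normal_kernel]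
        f.FactGroup_hom f.FactGroup_inj_on assms(3)] f.normal_kernel
    by (simp add: open_normal_def)
qed

lemma open_normal_vimage:
  assumes "group A" "f \<in> hom A B" "open_normal C B N"
  shows "open_normal C A {a \<in> carrier A. f a \<in> N}"
proof -
  interpret N: normal N B
    using assms(3) by (rule open_normal_normal)
  \<comment> \<open>The preimage of \<open>N\<close> is the kernel of the composite of
    \<open>f\<close> with the projection of \<open>B\<close> onto B/N.\<close>
  have "kernel A (B Mod N) ((#>\<^bsub>B\<^esub>) N \<circ> f) = {a \<in> carrier A. f a \<in> N}"
    using assms(2) N.r_coset_eq_subgroup_iff[OF N.is_subgroup] by (auto simp: kernel_def hom_def)
  then show ?thesis
    using open_normal_kernel[OF assms(1) Group.hom_compose[OF assms(2) N.r_coset_hom_Mod]] assms(3)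
    by (simp add: open_normal_def)
qed

lemma open_normal_Int:
  assumes "open_normal C A M" "open_normal C A N"
  shows "open_normal C A (M \<inter> N)"
proof -
  interpret M: normal M A
    using assms(1) by (rule open_normal_normal)
  interpret N: normal N A
    using assms(2) by (rule open_normal_normal)
  \<comment> \<open>The diagonal map to A/M \<times> A/N has kernel \<open>M \<inter> N\<close>, and
    \<open>C\<close> is closed under direct products.\<close>
  let ?f = "\<lambda>a. (M #>\<^bsub>A\<^esub> a, N #>\<^bsub>A\<^esub> a)"
  have "?f \<in> hom A ((A Mod M) \<times>\<times> (A Mod N))"
    using M.r_coset_hom_Mod N.r_coset_hom_Mod by (auto simp: hom_def)
  moreover have "belongs_to C ((A Mod M) \<times>\<times> (A Mod N))"
    using assms by (intro belongs_to_DirProd) (auto simp: open_normal_def)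
  moreover have "kernel A ((A Mod M) \<times>\<times> (A Mod N)) ?f = M \<inter> N"
    using M.r_coset_eq_subgroup_iff[OF M.is_subgroup] M.r_coset_eq_subgroup_iff[OF N.is_subgroup]
      M.subset N.subset unfolding kernel_def one_DirProd one_FactGroup by blast
  ultimately show ?thesis
    using open_normal_kernel[OF M.group_axioms] by metis
qed

lemma open_normal_Inter:
  assumes "finite \<N>" "\<N> \<noteq> {}" "\<And>N. N \<in> \<N> \<Longrightarrow> open_normal C A N"
  shows "open_normal C A (\<Inter>\<N>)"
  using assms by (induction rule: finite_ne_induct) (auto intro: open_normal_Int)

lemma open_normal_carrier:
  assumes "C \<noteq> {}" "group A"
  shows "open_normal C A (carrier A)"
proof -
  obtain M where M: "M \<in> C"
    using assms by blast
  interpret M: group M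
    using M by (rule member_group)
  have "kernel A M (\<lambda>_. \<one>\<^bsub>M\<^esub>) = carrier A"
    by (auto simp: kernel_def)
  moreover have "(\<lambda>_. \<one>\<^bsub>M\<^esub>) \<in> hom A M"
    by (simp add: hom_def)
  ultimately show ?thesis
    using open_normal_kernel[OF assms(2) _ belongs_to_member[OF M]] by metis
qed

lemma open_normal_finite_rcosets:
  assumes "open_normal C A N" shows "finite (rcosets\<^bsub>A\<^esub> N)"
  using assms belongs_to_finite[of "A Mod N"]
  unfolding open_normal_def carrier_FactGroup RCOSETS_def by (simp add: UNION_singleton_eq_range)

text \<open>Replaces homomorphisms to members of \<open>C\<close> by congruences in \<open>A\<close>
  itself: the kernel of a separating homomorphism serves as \<open>N\<close>, and conversely the
  projection onto A/N, followed by an isomorphism to a member of \<open>C\<close>,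
  separates.\<close>

lemma separated_by_hom_iff_open_normal:
  assumes A: "group A" and xy: "x \<in> carrier A" "y \<in> carrier A"
  shows "(\<exists>M\<in>C. \<exists>f\<in>hom A M. \<not> conjugate_in M (f x) (f y)) \<longleftrightarrow>
    (\<exists>N. open_normal C A N \<and>
      (\<forall>g\<in>carrier A. g \<otimes>\<^bsub>A\<^esub> x \<otimes>\<^bsub>A\<^esub> inv\<^bsub>A\<^esub> g \<otimes>\<^bsub>A\<^esub> inv\<^bsub>A\<^esub> y \<notin> N))" (is "?L \<longleftrightarrow> ?R")
proof -
  interpret group A by fact
  show ?thesis
  proof
    assume ?L
    then obtain M f where M: "M \<in> C" and f: "f \<in> hom A M"
      and nc: "\<not> conjugate_in M (f x) (f y)"
      by blast
    interpret f: group_hom A M f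
      using A f member_group[OF M] by (simp add: group_hom_def group_hom_axioms_def)
    have "g \<otimes>\<^bsub>A\<^esub> x \<otimes>\<^bsub>A\<^esub> inv\<^bsub>A\<^esub> g \<otimes>\<^bsub>A\<^esub> inv\<^bsub>A\<^esub> y \<notin> kernel A M f" if g: "g \<in> carrier A" for g
    proof
      assume "g \<otimes>\<^bsub>A\<^esub> x \<otimes>\<^bsub>A\<^esub> inv\<^bsub>A\<^esub> g \<otimes>\<^bsub>A\<^esub> inv\<^bsub>A\<^esub> y \<in> kernel A M f"
      then have "f g \<otimes>\<^bsub>M\<^esub> f x \<otimes>\<^bsub>M\<^esub> inv\<^bsub>M\<^esub> f g = f y"
        using g xy by (simp add: kernel_def f.H.inv_equality[symmetric] f.H.inv_solve_right')
      then show False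
        using nc f.hom_closed[OF g] unfolding conjugate_in_def by metis
    qed
    then show ?R
      using open_normal_kernel[OF A f belongs_to_member[OF M]] by blast
  next
    assume ?R
    then obtain N where N: "open_normal C A N"
      and nc: "\<And>g. g \<in> carrier A \<Longrightarrow> g \<otimes>\<^bsub>A\<^esub> x \<otimes>\<^bsub>A\<^esub> inv\<^bsub>A\<^esub> g \<otimes>\<^bsub>A\<^esub> inv\<^bsub>A\<^esub> y \<notin> N"
      by blast
    interpret N: normal N A
      using N by (rule open_normal_normal)
    obtain M f where M: "M \<in> C" and f: "f \<in> iso (A Mod N) M"
      using N by (auto simp: open_normal_def belongs_to_def is_iso_def)
    let ?h = "f \<circ> (#>\<^bsub>A\<^esub>) N"
    have "?h \<in> hom A M"
      using f N.r_coset_hom_Mod by (auto simp: iso_def intro: Group.hom_compose)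
    then interpret h: group_hom A M ?h
      using A member_group[OF M] by (simp add: group_hom_def group_hom_axioms_def)
    \<comment> \<open>Surjectivity lifts a conjugating element of \<open>M\<close> to
      \<open>A\<close>; injectivity brings the resulting equation back to A/N.\<close>
    have "f ` carrier (A Mod N) = carrier M" and inj: "inj_on f (carrier (A Mod N))"
      using f by (auto simp: iso_def bij_betw_def)
    then have surj: "carrier M = ?h ` carrier A"
      unfolding carrier_FactGroup by (simp add: image_comp)
    have "\<not> conjugate_in M (?h x) (?h y)"
    proof
      assume "conjugate_in M (?h x) (?h y)"
      then obtain g where g: "g \<in> carrier A"
        and "?h y = ?h g \<otimes>\<^bsub>M\<^esub> ?h x \<otimes>\<^bsub>M\<^esub> inv\<^bsub>M\<^esub> ?h g"
        unfolding conjugate_in_def surj by blast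
      then have "?h y = ?h (g \<otimes>\<^bsub>A\<^esub> x \<otimes>\<^bsub>A\<^esub> inv\<^bsub>A\<^esub> g)"
        using xy g by (simp del: comp_apply)
      then have "N #>\<^bsub>A\<^esub> (g \<otimes>\<^bsub>A\<^esub> x \<otimes>\<^bsub>A\<^esub> inv\<^bsub>A\<^esub> g) = N #>\<^bsub>A\<^esub> y"
        using inj xy g by (auto simp: carrier_FactGroup dest!: inj_onD)
      then have "g \<otimes>\<^bsub>A\<^esub> x \<otimes>\<^bsub>A\<^esub> inv\<^bsub>A\<^esub> g \<in> N #>\<^bsub>A\<^esub> y"
        using rcos_self[OF _ N.is_subgroup] xy g by (metis m_closed inv_closed)
      then have "g \<otimes>\<^bsub>A\<^esub> x \<otimes>\<^bsub>A\<^esub> inv\<^bsub>A\<^esub> g \<otimes>\<^bsub>A\<^esub> inv\<^bsub>A\<^esub> y \<in> N"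
        using N.rcos_module_imp A xy by blast
      then show False
        using nc g by blast
    qed
    then show ?L
      using M \<open>?h \<in> hom A M\<close> by blast
  qed
qed

section \<open>From topology to open normal subgroups; extensions and quotients\<close>

lemma open_subgroup_of_open_normal:
  assumes "group A" "open_normal C A K" "subgroup H A" "K \<subseteq> H"
  shows "openin (pro_topology C A) H"
proof -
  interpret group A by fact
  interpret H: subgroup H A by fact
  have sub: "K #>\<^bsub>A\<^esub> h \<subseteq> H" if "h \<in> H" for h
    using that assms(4) by (auto simp: r_coset_def)
  have "h \<in> K #>\<^bsub>A\<^esub> h" if "h \<in> H" for h
    using that rcos_self open_normal_subgroup[OF assms(2)] by simp
  \<comment> \<open>\<open>H\<close> is a union of cosets of \<open>K\<close>, each of which is a
    basic open set.\<close>
  then have "H = \<Union>((#>\<^bsub>A\<^esub>) K ` H)"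
    using sub by blast
  moreover have "openin (pro_topology C A) (K #>\<^bsub>A\<^esub> h)" if "h \<in> H" for h
  proof -
    have "h \<in> carrier A"
      using that by simp
    then show ?thesis
      unfolding pro_topology_def using assms(2) unfolding open_normal_def
      by (intro topology_generated_by_Basis) blast
  qed
  ultimately show ?thesis
    by (metis (no_types, lifting) imageE openin_Union)
qed

text \<open>The complement of \<open>S\<close> is open, hence contains a whole coset of some open
  normal subgroup around \<open>x\<close>. This is where closedness of a set is turned into
  algebra.\<close>

lemma closedin_pro_topology_avoid:
  assumes "C \<noteq> {}" "group A" "closedin (pro_topology C A) S" "x \<in> carrier A" "x \<notin> S"
  obtains K where "open_normal C A K" "\<And>k. k \<in> K \<Longrightarrow> k \<otimes>\<^bsub>A\<^esub> x \<notin> S"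
proof -
  interpret group A by fact
  let ?\<B> = "insert (carrier A)
       {N #>\<^bsub>A\<^esub> a | N a. N \<lhd> A \<and> belongs_to C (A Mod N) \<and> a \<in> carrier A}"
  \<comment> \<open>Induction over the generation of the topology: intersections use
    \<open>open_normal_Int\<close>, the basic set \<open>carrier A\<close> uses that
    \<open>C\<close> is nonempty, and any other basic set is a coset and so the coset of each of its
    points.\<close>
  have nbhd: "\<exists>K. open_normal C A K \<and> K #>\<^bsub>A\<^esub> x \<subseteq> U"
    if "generate_topology_on ?\<B> U" "x \<in> U" "x \<in> carrier A" for U x
    using that
  proof induction
    case (Int U V)
    then obtain K L where "open_normal C A K" "K #>\<^bsub>A\<^esub> x \<subseteq> U"
        "open_normal C A L" "L #>\<^bsub>A\<^esub> x \<subseteq> V"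
      by blast
    then have "open_normal C A (K \<inter> L)" "(K \<inter> L) #>\<^bsub>A\<^esub> x \<subseteq> U \<inter> V"
      by (auto simp: r_coset_def intro: open_normal_Int)
    then show ?case by blast
  next
    case (Basis U)
    show ?case
    proof (cases "U = carrier A")
      case True
      with Basis have "carrier A #>\<^bsub>A\<^esub> x \<subseteq> U"
        by (auto simp: r_coset_def)
      then show ?thesis
        using open_normal_carrier[OF assms(1,2)] by blast
    next
      case False
      with Basis obtain N a where N: "open_normal C A N" "a \<in> carrier A" "U = N #>\<^bsub>A\<^esub> a"
        by (auto simp: open_normal_def)
      with Basis have "N #>\<^bsub>A\<^esub> x = U"
        using repr_independence[of x N a] open_normal_subgroup by fastforce
      with N show ?thesis by blast
    qed
  qed blast+
  have "topspace (pro_topology C A) = carrier A"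
  proof -
    have "N #>\<^bsub>A\<^esub> a \<subseteq> carrier A" if "N \<lhd> A" "a \<in> carrier A" for N a
      using that by (meson normal_imp_subgroup r_coset_subset_G subgroup.subset)
    then show ?thesis
      unfolding pro_topology_def topology_generated_by_topspace by blast
  qed
  then have "generate_topology_on ?\<B> (carrier A - S)"
    using assms(3) by (simp add: closedin_def pro_topology_def openin_topology_generated_by_iff)
  from nbhd[OF this, of x] assms(4,5) obtain K
    where "open_normal C A K" "K #>\<^bsub>A\<^esub> x \<subseteq> carrier A - S"
    by blast
  then show thesis
    by (intro that[of K]) (auto simp: r_coset_def)
qed

text \<open>\<open>extension_closed\<close> speaks only of groups over \<open>nat\<close>. Here
  \<open>A\<close> is finite, since its kernel is finite and has finite index, so it has an
  isomorphic copy over \<open>nat\<close> to which the closure property applies.\<close>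

lemma belongs_to_extension:
  assumes ext: "extension_closed C" and A: "group A" and f: "f \<in> hom A B"
    and B: "belongs_to C B" and ker: "belongs_to C (A\<lparr>carrier := kernel A B f\<rparr>)"
  shows "belongs_to C A"
proof -
  interpret f: group_hom A B f
    using A f B by (auto simp: group_hom_def group_hom_axioms_def belongs_to_def)
  let ?K = "kernel A B f"
  have "finite (rcosets\<^bsub>A\<^esub> ?K)"
    using open_normal_kernel[OF A f B] by (rule open_normal_finite_rcosets)
  moreover have "finite ?K"
    using belongs_to_finite[OF ker] by simp
  then have "finite S" if "S \<in> rcosets\<^bsub>A\<^esub> ?K" for S
    using that by (auto simp: RCOSETS_def r_coset_def)
  ultimately have fin: "finite (carrier A)"
    using f.G.rcosets_part_G[OF f.subgroup_kernel] by (metis finite_Union)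
  obtain e :: "_ \<Rightarrow> nat" where e: "inj_on e (carrier A)"
    using finite_imp_inj_to_nat_seg[OF fin] by blast
  define d where "d = inv_into (carrier A) e"
  \<comment> \<open>The group structure of \<open>A\<close> is transported along the injection
    \<open>e\<close>, with \<open>d\<close> as its inverse.\<close>
  define A' :: "nat monoid" where
    "A' = \<lparr>carrier = e ` carrier A, monoid.mult = \<lambda>i j. e (d i \<otimes>\<^bsub>A\<^esub> d j), one = e \<one>\<^bsub>A\<^esub>\<rparr>"
  have d: "d (e x) = x" if "x \<in> carrier A" for x
    using e that by (simp add: d_def)
  have eiso: "e \<in> iso A A'"
    using e by (auto simp: iso_def hom_def A'_def bij_betw_def d)
  have "A'\<lparr>one := e \<one>\<^bsub>A\<^esub>\<rparr> = A'"
    by (simp add: A'_def)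
  then have A': "group A'"
    using f.G.iso_imp_img_group[OF eiso] by simp
  have diso: "d \<in> iso A' A"
    using f.G.iso_set_sym[OF eiso] by (simp add: d_def A'_def)
  have fd: "f \<circ> d \<in> hom A' B"
    using diso f by (auto simp: iso_def intro: Group.hom_compose)
  let ?K' = "kernel A' B (f \<circ> d)"
  have K': "open_normal C A' ?K'"
    using open_normal_kernel[OF A' fd B] .
  have "d \<in> hom (A'\<lparr>carrier := ?K'\<rparr>) (A\<lparr>carrier := ?K\<rparr>)"
    using diso by (auto simp: iso_def hom_def kernel_def)
  moreover have "inj_on d ?K'"
    using diso by (auto simp: iso_def bij_betw_def kernel_def intro: inj_on_subset)
  ultimately have "belongs_to C (A'\<lparr>carrier := ?K'\<rparr>)"
    using group.subgroup_imp_group[OF A' open_normal_subgroup[OF K']] ker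
    by (auto intro: belongs_to_embed)
  then have "A' \<in> C"
    using ext K' unfolding extension_closed_def open_normal_def by blast
  then show ?thesis
    using A eiso by (auto simp: belongs_to_def is_iso_def)
qed

text \<open>A/L is an extension of A/K by K/L, and both of these belong to \<open>C\<close>.\<close>

lemma open_normal_trans:
  assumes ext: "extension_closed C" and K: "open_normal C A K" and L: "L \<lhd> A" "L \<subseteq> K"
    and LK: "open_normal C (A\<lparr>carrier := K\<rparr>) L"
  shows "open_normal C A L"
proof -
  interpret K: normal K A
    using K by (rule open_normal_normal)
  interpret L: normal L A by fact
  have A: "group A"
    by (rule K.group_axioms)
  have AK: "group (A Mod K)"
    by (rule K.factorgroup_is_group)
  have AL: "group (A Mod L)"
    by (rule L.factorgroup_is_group)
  interpret h: group_hom A "A Mod K" "(#>\<^bsub>A\<^esub>) K"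
    using A AK K.r_coset_hom_Mod by (simp add: group_hom_def group_hom_axioms_def)
  have "L \<subseteq> kernel A (A Mod K) ((#>\<^bsub>A\<^esub>) K)"
    using L K.kernel_r_coset by simp
  then obtain g where g: "g \<in> hom (A Mod L) (A Mod K)"
      and g_eq: "\<And>x. x \<in> carrier A \<Longrightarrow> g (L #>\<^bsub>A\<^esub> x) = K #>\<^bsub>A\<^esub> x"
    using h.FactGroup_universal_kernel[OF L(1)] by blast
  let ?ker = "kernel (A Mod L) (A Mod K) g"
  \<comment> \<open>The kernel of the natural map from A/L to A/K consists of the cosets of
    \<open>L\<close> inside \<open>K\<close>; it is K/L even as a set, so the identity map serves as
    the embedding below.\<close>
  have "?ker = rcosets\<^bsub>A\<lparr>carrier := K\<rparr>\<^esub> L"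
  proof -
    have "S \<in> ?ker \<longleftrightarrow> (\<exists>x\<in>carrier A. S = L #>\<^bsub>A\<^esub> x \<and> K #>\<^bsub>A\<^esub> x = K)" for S
      unfolding kernel_def carrier_FactGroup one_FactGroup using g_eq by auto
    also have "\<dots> S \<longleftrightarrow> (\<exists>x\<in>K. S = L #>\<^bsub>A\<^esub> x)" for S
      using K.r_coset_eq_subgroup_iff[OF K.is_subgroup] K.subset by blast
    finally show ?thesis
      by (auto simp: RCOSETS_def r_coset_def)
  qed
  then have "(\<lambda>S. S) \<in> hom ((A Mod L)\<lparr>carrier := ?ker\<rparr>) ((A\<lparr>carrier := K\<rparr>) Mod L)"
    by (auto simp: hom_def FactGroup_def set_mult_def)
  moreover have "group ((A Mod L)\<lparr>carrier := ?ker\<rparr>)"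
    using AL AK g by (intro group.subgroup_imp_group group_hom.subgroup_kernel)
      (auto simp: group_hom_def group_hom_axioms_def)
  ultimately have "belongs_to C ((A Mod L)\<lparr>carrier := ?ker\<rparr>)"
    using LK by (auto simp: open_normal_def intro: belongs_to_embed)
  then have "belongs_to C (A Mod L)"
    using belongs_to_extension[OF ext AL g] K by (simp add: open_normal_def)
  then show ?thesis
    using L by (simp add: open_normal_def)
qed

text \<open>The image of \<open>u\<close> in A/N avoids the closed cyclic subgroup \<open>H\<close>
  generated by the image of \<open>x\<close>. An open normal subgroup of A/N keeps a neighbourhood
  of it away from \<open>H\<close>, and its preimage is \<open>K\<close>.\<close>

lemma cyclic_subgroup_separable_quotient:
  assumes A: "group A" and C: "C \<noteq> {}" and N: "N \<lhd> A"
    and sep: "cyclic_subgroup_separable C (A Mod N)"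
    and x: "x \<in> carrier A" and u: "u \<in> carrier A"
    and notin: "\<And>(n::int) a. a \<in> N \<Longrightarrow> u \<noteq> x [^]\<^bsub>A\<^esub> n \<otimes>\<^bsub>A\<^esub> a"
  obtains K where "open_normal C A K" "N \<subseteq> K"
    "\<And>(n::int) k. k \<in> K \<Longrightarrow> u \<noteq> x [^]\<^bsub>A\<^esub> n \<otimes>\<^bsub>A\<^esub> k"
proof -
  interpret N: normal N A by fact
  interpret Q: group "A Mod N"
    by (rule N.factorgroup_is_group)
  have mem: "N #>\<^bsub>A\<^esub> a \<in> carrier (A Mod N)" if "a \<in> carrier A" for a
    using that by (simp add: carrier_FactGroup)
  define H where "H = range (\<lambda>n::int. N #>\<^bsub>A\<^esub> (x [^]\<^bsub>A\<^esub> n))"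
  have H_eq: "H = range (\<lambda>n::int. (N #>\<^bsub>A\<^esub> x) [^]\<^bsub>A Mod N\<^esub> n)"
    by (simp add: H_def N.FactGroup_int_pow[OF x])
  have H: "subgroup H (A Mod N)"
    unfolding H_eq by (rule Q.subgroup_of_powers[OF mem[OF x]])
  have xH: "N #>\<^bsub>A\<^esub> x \<in> H"
    unfolding H_def using x by (metis N.int_pow_1 rangeI)
  have "cyclic_group ((A Mod N)\<lparr>carrier := H\<rparr>)"
  proof -
    interpret H: group "(A Mod N)\<lparr>carrier := H\<rparr>"
      by (rule Q.subgroup_imp_group[OF H])
    have "H = range (\<lambda>n::int. (N #>\<^bsub>A\<^esub> x) [^]\<^bsub>(A Mod N)\<lparr>carrier := H\<rparr>\<^esub> n)"
      unfolding Q.int_pow_consistent[OF H xH, symmetric] by (rule H_eq)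
    then show ?thesis
      unfolding H.cyclic_group using xH by auto
  qed
  then have "closedin (pro_topology C (A Mod N)) H"
    using sep H by (simp add: cyclic_subgroup_separable_def)
  moreover have "N #>\<^bsub>A\<^esub> u \<notin> H"
  proof
    assume "N #>\<^bsub>A\<^esub> u \<in> H"
    then obtain n :: int where "N #>\<^bsub>A\<^esub> u = N #>\<^bsub>A\<^esub> (x [^]\<^bsub>A\<^esub> n)"
      by (auto simp: H_def)
    then have "u \<in> x [^]\<^bsub>A\<^esub> n <#\<^bsub>A\<^esub> N"
      using N.rcos_self[OF u N.is_subgroup] N.coset_eq x by simp
    then show False
      using notin by (auto simp: l_coset_def)
  qed
  ultimately obtain K' where K': "open_normal C (A Mod N) K'"
    and nK': "\<And>k. k \<in> K' \<Longrightarrow> k \<otimes>\<^bsub>A Mod N\<^esub> (N #>\<^bsub>A\<^esub> u) \<notin> H"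
    using closedin_pro_topology_avoid[OF C Q.group_axioms _ mem[OF u]] by blast
  interpret K': normal K' "A Mod N"
    using K' by (rule open_normal_normal)
  define K where "K = {a \<in> carrier A. N #>\<^bsub>A\<^esub> a \<in> K'}"
  have K: "open_normal C A K"
    unfolding K_def by (rule open_normal_vimage[OF A N.r_coset_hom_Mod K'])
  have NK: "N \<subseteq> K"
  proof
    fix a assume "a \<in> N"
    then show "a \<in> K"
      using N.r_coset_eq_subgroup_iff[OF N.is_subgroup, of a] subgroup.one_closed[OF K'.is_subgroup]
      by (simp add: K_def)
  qed
  interpret K: normal K A
    using K by (rule open_normal_normal)
  have "u \<noteq> x [^]\<^bsub>A\<^esub> n \<otimes>\<^bsub>A\<^esub> k" if k: "k \<in> K" for k and n :: int
  proof
    assume un: "u = x [^]\<^bsub>A\<^esub> n \<otimes>\<^bsub>A\<^esub> k"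
    have kA: "k \<in> carrier A"
      using k by simp
    have xn: "x [^]\<^bsub>A\<^esub> n \<in> carrier A"
      using x by simp
    \<comment> \<open>Separation in the quotient concerns factors on the left of \<open>u\<close>,
      whereas \<open>k\<close> stands on the right. The conjugate \<open>?l\<close> of the inverse
      of \<open>k\<close> satisfies \<open>?l\<close> times \<open>u\<close> = \<open>x\<close> to
      the power \<open>n\<close>.\<close>
    let ?l = "x [^]\<^bsub>A\<^esub> n \<otimes>\<^bsub>A\<^esub> inv\<^bsub>A\<^esub> k \<otimes>\<^bsub>A\<^esub> inv\<^bsub>A\<^esub> (x [^]\<^bsub>A\<^esub> n)"
    have "?l \<in> K"
      using k xn by (intro K.inv_op_closed2) auto
    then have "N #>\<^bsub>A\<^esub> ?l \<in> K'"
      unfolding K_def by blast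
    moreover have "(N #>\<^bsub>A\<^esub> ?l) \<otimes>\<^bsub>A Mod N\<^esub> (N #>\<^bsub>A\<^esub> u) = N #>\<^bsub>A\<^esub> (x [^]\<^bsub>A\<^esub> n)"
      using xn kA u by (simp add: N.rcos_sum) (simp add: un N.word_simps)
    ultimately show False
      using nK' by (force simp: H_def)
  qed
  then show thesis
    using K NK that by blast
qed

end

section \<open>Centralizers modulo open normal subgroups\<close>

context
  fixes C :: group_class
  assumes pseudovariety: "pseudovariety_of_finite_groups C" and ext: "extension_closed C"
begin

text \<open>\<open>L\<close> is the intersection of all conjugates of \<open>M\<close> under
  \<open>A\<close>. As \<open>M\<close> is normal in \<open>K\<close>, a conjugate depends only on a
  coset of \<open>K\<close>, so there are finitely many of them; hence \<open>L\<close> is open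
  normal in \<open>K\<close>, and \<open>open_normal_trans\<close> makes it open normal in
  \<open>A\<close>.\<close>

lemma open_normal_core:
  assumes K: "open_normal C A K" and M: "open_normal C (A\<lparr>carrier := K\<rparr>) M"
  obtains L where "open_normal C A L" "L \<subseteq> M"
proof -
  interpret K: normal K A
    using K by (rule open_normal_normal)
  let ?K = "A\<lparr>carrier := K\<rparr>"
  interpret M: normal M ?K
    using M by (rule open_normal_normal)
  have KG: "group ?K"
    using K.subgroup_imp_group[OF K.is_subgroup] .
  have MK: "M \<subseteq> K"
    using M.subset by simp
  \<comment> \<open>\<open>T a\<close> is the conjugate of \<open>M\<close> by the inverse of
    \<open>a\<close>.\<close>
  define T where "T a = {k \<in> K. a \<otimes>\<^bsub>A\<^esub> k \<otimes>\<^bsub>A\<^esub> inv\<^bsub>A\<^esub> a \<in> M}" for a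
  have conj_closed: "k \<otimes>\<^bsub>A\<^esub> m \<otimes>\<^bsub>A\<^esub> inv\<^bsub>A\<^esub> k \<in> M" if "k \<in> K" "m \<in> M" for k m
    using M.inv_op_closed2[of k m] that K.m_inv_consistent[OF K.is_subgroup, of k] by simp
  have T_open: "open_normal C ?K (T a)" if a: "a \<in> carrier A" for a
  proof -
    have "(\<lambda>k. a \<otimes>\<^bsub>A\<^esub> k \<otimes>\<^bsub>A\<^esub> inv\<^bsub>A\<^esub> a) \<in> hom ?K ?K"
      using a by (auto simp: hom_def K.inv_op_closed2) (simp add: K.word_simps)
    then show ?thesis
      using open_normal_vimage[OF pseudovariety KG _ M] by (simp add: T_def)
  qed
  have T_sub: "T a \<subseteq> T (k \<otimes>\<^bsub>A\<^esub> a)" if a: "a \<in> carrier A" and k: "k \<in> K" for a k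
  proof
    fix t assume t: "t \<in> T a"
    then have "k \<otimes>\<^bsub>A\<^esub> (a \<otimes>\<^bsub>A\<^esub> t \<otimes>\<^bsub>A\<^esub> inv\<^bsub>A\<^esub> a) \<otimes>\<^bsub>A\<^esub> inv\<^bsub>A\<^esub> k \<in> M"
      using k by (auto simp: T_def intro: conj_closed)
    with t a k show "t \<in> T (k \<otimes>\<^bsub>A\<^esub> a)"
      by (auto simp: T_def K.word_simps)
  qed
  have T_coset: "T b = T a" if a: "a \<in> carrier A" and b: "b \<in> K #>\<^bsub>A\<^esub> a" for a b
  proof -
    obtain k where k: "k \<in> K" "b = k \<otimes>\<^bsub>A\<^esub> a"
      using b by (auto simp: r_coset_def)
    then have "a = inv\<^bsub>A\<^esub> k \<otimes>\<^bsub>A\<^esub> b" "b \<in> carrier A"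
      using a by (auto simp: K.m_assoc[symmetric])
    then show ?thesis
      using T_sub[OF a k(1)] T_sub[of b "inv\<^bsub>A\<^esub> k"] k by auto
  qed
  \<comment> \<open>\<open>T\<close> factors through the finitely many cosets of \<open>K\<close>,
    each represented by a chosen element.\<close>
  have "T a \<in> (\<lambda>S. T (SOME b. b \<in> S)) ` (rcosets\<^bsub>A\<^esub> K)" if a: "a \<in> carrier A" for a
  proof
    have "(SOME b. b \<in> K #>\<^bsub>A\<^esub> a) \<in> K #>\<^bsub>A\<^esub> a"
      using K.rcos_self[OF a K.is_subgroup] by (rule someI)
    then show "T a = T (SOME b. b \<in> K #>\<^bsub>A\<^esub> a)"
      using T_coset[OF a] by simp
    show "K #>\<^bsub>A\<^esub> a \<in> rcosets\<^bsub>A\<^esub> K"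
      using a K.subset by (simp add: K.rcosetsI)
  qed
  then have fin: "finite (T ` carrier A)"
    using open_normal_finite_rcosets[OF pseudovariety K]
    by (meson finite_imageI finite_subset image_subsetI)
  let ?L = "\<Inter>(T ` carrier A)"
  have L: "open_normal C ?K ?L"
    using T_open by (intro open_normal_Inter[OF pseudovariety fin]) auto
  have LM: "?L \<subseteq> M"
  proof
    fix l assume "l \<in> ?L"
    then have "l \<in> T \<one>\<^bsub>A\<^esub>" by blast
    then show "l \<in> M" using K.mem_carrier by (auto simp: T_def)
  qed
  have "?L \<lhd> A"
  proof (rule K.normal_invI)
    show "subgroup ?L A"
      using K.incl_subgroup[OF K.is_subgroup open_normal_subgroup[OF L]] .
    fix g l assume g: "g \<in> carrier A" and l: "l \<in> ?L"
    show "g \<otimes>\<^bsub>A\<^esub> l \<otimes>\<^bsub>A\<^esub> inv\<^bsub>A\<^esub> g \<in> ?L"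
    \<comment> \<open>Conjugating an element by \<open>g\<close> shifts the index of
      \<open>T\<close> from \<open>a\<close> to the product of \<open>a\<close> and
      \<open>g\<close>, which merely permutes the family.\<close>
    proof (intro INT_I)
      fix a assume a: "a \<in> carrier A"
      have "l \<in> T (a \<otimes>\<^bsub>A\<^esub> g)"
        using l a g by blast
      with a g show "g \<otimes>\<^bsub>A\<^esub> l \<otimes>\<^bsub>A\<^esub> inv\<^bsub>A\<^esub> g \<in> T a"
        by (auto simp: T_def K.word_simps)
         (use K.inv_op_closed2[OF g] l in \<open>auto simp: K.m_assoc\<close>)
    qed
  qed
  moreover have "?L \<subseteq> K"
    using LM MK by (rule subset_trans)
  ultimately have "open_normal C A ?L"
    using open_normal_trans[OF pseudovariety ext K _ _ L] by blast
  then show thesis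
    using LM that by blast
qed

lemma centralizer_condition_coset:
  assumes A: "group A" and hcs: "hereditarily_conjugacy_separable C A"
    and K: "open_normal C A K" and x: "x \<in> carrier A" and z: "z \<in> carrier A"
    and disj: "(K #>\<^bsub>A\<^esub> z) \<inter> centralizer A x = {}"
  obtains L where "open_normal C A L"
    "\<And>g. g \<in> K #>\<^bsub>A\<^esub> z \<Longrightarrow> g \<otimes>\<^bsub>A\<^esub> x \<otimes>\<^bsub>A\<^esub> inv\<^bsub>A\<^esub> g \<otimes>\<^bsub>A\<^esub> inv\<^bsub>A\<^esub> x \<notin> L"
proof -
  interpret K: normal K A
    using K by (rule open_normal_normal)
  \<comment> \<open>Elements of \<open>H = K\<langle>x\<rangle>\<close> conjugate \<open>x\<close> in the same ways as elements of \<open>K\<close>, so by \<open>disj\<close> the conjugate \<open>w\<close>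
    of \<open>x\<close> by \<open>z\<close> is not conjugate to \<open>x\<close> in \<open>H\<close>, and \<open>H\<close> is open, hence conjugacy separable.\<close>
  define P where "P = range (\<lambda>n::int. x [^]\<^bsub>A\<^esub> n)"
  have P: "subgroup P A"
    unfolding P_def using x by (rule K.subgroup_of_powers)
  define H where "H = K <#>\<^bsub>A\<^esub> P"
  have H: "subgroup H A"
    unfolding H_def using open_normal_normal[OF K] P by (rule K.mult_norm_subgroup)
  interpret H: subgroup H A
    by (rule H)
  have xP: "x \<in> P"
    unfolding P_def using x by (metis K.int_pow_1 rangeI)
  have HI: "k \<otimes>\<^bsub>A\<^esub> p \<in> H" if "k \<in> K" "p \<in> P" for k p
    unfolding H_def set_mult_def using that by blast
  have KH: "K \<subseteq> H"
  proof
    fix k assume "k \<in> K"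
    then show "k \<in> H"
      using HI[OF _ subgroup.one_closed[OF P], of k] by simp
  qed
  have xH: "x \<in> H"
    using HI[OF subgroup.one_closed[OF K.is_subgroup] xP] x by simp
  define w where "w = z \<otimes>\<^bsub>A\<^esub> x \<otimes>\<^bsub>A\<^esub> inv\<^bsub>A\<^esub> z"
  have wA: "w \<in> carrier A"
    using x z by (simp add: w_def)
  have coset: "\<exists>k\<in>K. g = k \<otimes>\<^bsub>A\<^esub> z \<and> g \<otimes>\<^bsub>A\<^esub> x \<otimes>\<^bsub>A\<^esub> inv\<^bsub>A\<^esub> g = k \<otimes>\<^bsub>A\<^esub> w \<otimes>\<^bsub>A\<^esub> inv\<^bsub>A\<^esub> k"
    if "g \<in> K #>\<^bsub>A\<^esub> z" for g
  proof -
    obtain k where "k \<in> K" "g = k \<otimes>\<^bsub>A\<^esub> z"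
      using \<open>g \<in> K #>\<^bsub>A\<^esub> z\<close> by (auto simp: r_coset_def)
    with x z show ?thesis
      by (auto simp: w_def K.word_simps)
  qed
  show thesis
  proof (cases "w \<in> H")
    \<comment> \<open>Here \<open>K\<close> itself serves as \<open>L\<close>: if a conjugate of
      \<open>w\<close> by an element of \<open>K\<close> were congruent to \<open>x\<close> modulo
      \<open>K\<close>, it would lie in \<open>H\<close>, and so would \<open>w\<close>.\<close>
    case False
    have "g \<otimes>\<^bsub>A\<^esub> x \<otimes>\<^bsub>A\<^esub> inv\<^bsub>A\<^esub> g \<otimes>\<^bsub>A\<^esub> inv\<^bsub>A\<^esub> x \<notin> K" if g: "g \<in> K #>\<^bsub>A\<^esub> z" for g
    proof
      assume gK: "g \<otimes>\<^bsub>A\<^esub> x \<otimes>\<^bsub>A\<^esub> inv\<^bsub>A\<^esub> g \<otimes>\<^bsub>A\<^esub> inv\<^bsub>A\<^esub> x \<in> K"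
      obtain k where k: "k \<in> K" "g \<otimes>\<^bsub>A\<^esub> x \<otimes>\<^bsub>A\<^esub> inv\<^bsub>A\<^esub> g = k \<otimes>\<^bsub>A\<^esub> w \<otimes>\<^bsub>A\<^esub> inv\<^bsub>A\<^esub> k"
        using coset[OF g] by blast
      have kA: "k \<in> carrier A"
        using k by simp
      have "k \<otimes>\<^bsub>A\<^esub> w \<otimes>\<^bsub>A\<^esub> inv\<^bsub>A\<^esub> k \<otimes>\<^bsub>A\<^esub> inv\<^bsub>A\<^esub> x \<in> H"
        using gK k KH by auto
      then have "inv\<^bsub>A\<^esub> k \<otimes>\<^bsub>A\<^esub> (k \<otimes>\<^bsub>A\<^esub> w \<otimes>\<^bsub>A\<^esub> inv\<^bsub>A\<^esub> k \<otimes>\<^bsub>A\<^esub> inv\<^bsub>A\<^esub> x) \<otimes>\<^bsub>A\<^esub> x \<otimes>\<^bsub>A\<^esub> k \<in> H"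
        using k KH xH by (meson H.m_closed H.m_inv_closed subsetD)
      moreover have "inv\<^bsub>A\<^esub> k \<otimes>\<^bsub>A\<^esub> (k \<otimes>\<^bsub>A\<^esub> w \<otimes>\<^bsub>A\<^esub> inv\<^bsub>A\<^esub> k \<otimes>\<^bsub>A\<^esub> inv\<^bsub>A\<^esub> x) \<otimes>\<^bsub>A\<^esub> x \<otimes>\<^bsub>A\<^esub> k = w"
        using kA wA x by (simp add: K.word_simps)
      ultimately show False
        using False by simp
    qed
    then show thesis
      using K that by blast
  next
    case True
    let ?H = "A\<lparr>carrier := H\<rparr>"
    have HG: "group ?H"
      using K.subgroup_imp_group[OF H] .
    have cs: "conjugacy_separable C ?H"
      using hcs H open_subgroup_of_open_normal[OF pseudovariety A K H KH]
      by (simp add: hereditarily_conjugacy_separable_def)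
    have nconj: "\<not> conjugate_in ?H x w"
    proof
      assume "conjugate_in ?H x w"
      then obtain h where h: "h \<in> H" "w = h \<otimes>\<^bsub>A\<^esub> x \<otimes>\<^bsub>A\<^esub> inv\<^bsub>A\<^esub> h"
        by (auto simp: conjugate_in_def K.m_inv_consistent[OF H])
      then obtain k n where k: "k \<in> K" and hk: "h = k \<otimes>\<^bsub>A\<^esub> x [^]\<^bsub>A\<^esub> (n::int)"
        by (auto simp: H_def set_mult_def P_def)
      have kA: "k \<in> carrier A"
        using k by simp
      have hA: "h \<in> carrier A"
        using h by simp
      have xn: "x [^]\<^bsub>A\<^esub> n \<in> carrier A"
        using x by simp
      have comm: "x [^]\<^bsub>A\<^esub> n \<otimes>\<^bsub>A\<^esub> x = x \<otimes>\<^bsub>A\<^esub> x [^]\<^bsub>A\<^esub> n"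
        using x by (metis K.int_pow_1 K.int_pow_mult add.commute)
      \<comment> \<open>The power of \<open>x\<close> in \<open>h\<close> commutes with
        \<open>x\<close>, so \<open>h\<close> conjugates \<open>x\<close> exactly as
        \<open>k\<close> does. Then the inverse of \<open>k\<close> times \<open>z\<close>
        centralizes \<open>x\<close> and lies in the coset of \<open>z\<close>, against
        \<open>disj\<close>.\<close>
      have "h \<otimes>\<^bsub>A\<^esub> x = k \<otimes>\<^bsub>A\<^esub> x \<otimes>\<^bsub>A\<^esub> inv\<^bsub>A\<^esub> k \<otimes>\<^bsub>A\<^esub> h"
        unfolding hk using kA x xn comm by (simp add: K.word_simps)
      then have "w = k \<otimes>\<^bsub>A\<^esub> x \<otimes>\<^bsub>A\<^esub> inv\<^bsub>A\<^esub> k \<otimes>\<^bsub>A\<^esub> h \<otimes>\<^bsub>A\<^esub> inv\<^bsub>A\<^esub> h"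
        using h(2) by simp
      also have "\<dots> = k \<otimes>\<^bsub>A\<^esub> x \<otimes>\<^bsub>A\<^esub> inv\<^bsub>A\<^esub> k"
        using hA kA x by (simp add: K.m_assoc)
      finally have "w = k \<otimes>\<^bsub>A\<^esub> x \<otimes>\<^bsub>A\<^esub> inv\<^bsub>A\<^esub> k" .
      then have "z \<otimes>\<^bsub>A\<^esub> x = k \<otimes>\<^bsub>A\<^esub> x \<otimes>\<^bsub>A\<^esub> inv\<^bsub>A\<^esub> k \<otimes>\<^bsub>A\<^esub> z"
        using kA x z by (simp add: w_def K.inv_solve_right')
      then have "inv\<^bsub>A\<^esub> k \<otimes>\<^bsub>A\<^esub> z \<in> centralizer A x"
        using kA x z by (simp add: centralizer_def K.word_simps)
      moreover have "inv\<^bsub>A\<^esub> k \<otimes>\<^bsub>A\<^esub> z \<in> K #>\<^bsub>A\<^esub> z"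
        using k by (auto simp: r_coset_def)
      ultimately show False
        using disj by blast
    qed
    have "x \<in> carrier ?H" "w \<in> carrier ?H"
      using xH True by simp_all
    with cs nconj obtain M where M: "open_normal C ?H M"
      and "\<forall>h\<in>carrier ?H. h \<otimes>\<^bsub>?H\<^esub> x \<otimes>\<^bsub>?H\<^esub> inv\<^bsub>?H\<^esub> h \<otimes>\<^bsub>?H\<^esub> inv\<^bsub>?H\<^esub> w \<notin> M"
      using separated_by_hom_iff_open_normal[OF pseudovariety HG, of x w]
      unfolding conjugacy_separable_def by blast
    then have nM: "h \<otimes>\<^bsub>A\<^esub> x \<otimes>\<^bsub>A\<^esub> inv\<^bsub>A\<^esub> h \<otimes>\<^bsub>A\<^esub> inv\<^bsub>A\<^esub> w \<notin> M" if "h \<in> H" for h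
      using that True K.m_inv_consistent[OF H] by simp
    interpret M: normal M ?H
      using M by (rule open_normal_normal)
    let ?K = "A\<lparr>carrier := K\<rparr>"
    \<comment> \<open>\<open>M\<close> is normal only in \<open>H\<close>. Its intersection with
      \<open>K\<close> is open normal in \<open>K\<close>, and \<open>open_normal_core\<close> finds
      inside it a subgroup that is open normal in all of \<open>A\<close>.\<close>
    have "open_normal C ?K {k \<in> K. k \<in> M}"
      using open_normal_vimage[OF pseudovariety K.subgroup_imp_group[OF K.is_subgroup], of "\<lambda>k. k" ?H M] KH M
      by (auto simp: hom_def)
    then obtain L where L: "open_normal C A L" "L \<subseteq> {k \<in> K. k \<in> M}"
      using open_normal_core[OF K] by blast
    have "g \<otimes>\<^bsub>A\<^esub> x \<otimes>\<^bsub>A\<^esub> inv\<^bsub>A\<^esub> g \<otimes>\<^bsub>A\<^esub> inv\<^bsub>A\<^esub> x \<notin> L" if g: "g \<in> K #>\<^bsub>A\<^esub> z" for g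
    proof
      assume gL: "g \<otimes>\<^bsub>A\<^esub> x \<otimes>\<^bsub>A\<^esub> inv\<^bsub>A\<^esub> g \<otimes>\<^bsub>A\<^esub> inv\<^bsub>A\<^esub> x \<in> L"
      obtain k where k: "k \<in> K" "g \<otimes>\<^bsub>A\<^esub> x \<otimes>\<^bsub>A\<^esub> inv\<^bsub>A\<^esub> g = k \<otimes>\<^bsub>A\<^esub> w \<otimes>\<^bsub>A\<^esub> inv\<^bsub>A\<^esub> k"
        using coset[OF g] by blast
      have kA: "k \<in> carrier A"
        using k by simp
      have kH: "k \<in> H"
        using k KH by blast
      let ?m = "k \<otimes>\<^bsub>A\<^esub> w \<otimes>\<^bsub>A\<^esub> inv\<^bsub>A\<^esub> k \<otimes>\<^bsub>A\<^esub> inv\<^bsub>A\<^esub> x"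
      have m: "?m \<in> M"
        using gL k L by auto
      then have "inv\<^bsub>?H\<^esub> ?m \<in> M" "?m \<in> H"
        using M.subset by auto
      then have "inv\<^bsub>A\<^esub> ?m \<in> M"
        by (simp only: K.m_inv_consistent[OF H])
      then have "inv\<^bsub>A\<^esub> k \<otimes>\<^bsub>A\<^esub> inv\<^bsub>A\<^esub> ?m \<otimes>\<^bsub>A\<^esub> k \<in> M"
        using M.inv_op_closed1[of k "inv\<^bsub>A\<^esub> ?m"] kH K.m_inv_consistent[OF H, of k] by simp
      \<comment> \<open>\<open>M\<close> excludes conjugates of \<open>x\<close> that are congruent
        to \<open>w\<close>, whereas \<open>?m\<close> compares a conjugate of \<open>w\<close> with
        \<open>x\<close>. Inverting and conjugating by the inverse of \<open>k\<close> exchanges the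
        two roles.\<close>
      moreover have "inv\<^bsub>A\<^esub> k \<otimes>\<^bsub>A\<^esub> inv\<^bsub>A\<^esub> ?m \<otimes>\<^bsub>A\<^esub> k
          = inv\<^bsub>A\<^esub> k \<otimes>\<^bsub>A\<^esub> x \<otimes>\<^bsub>A\<^esub> inv\<^bsub>A\<^esub> (inv\<^bsub>A\<^esub> k) \<otimes>\<^bsub>A\<^esub> inv\<^bsub>A\<^esub> w"
        using kA wA x by (simp add: K.word_simps)
      ultimately show False
        using nM[of "inv\<^bsub>A\<^esub> k"] kH by auto
    qed
    then show thesis
      using L that by blast
  qed
qed

text \<open>The cosets of \<open>K\<close> are treated separately. One that meets the centralizer in
  \<open>c\<close> equals c K, so all its elements have the desired form; one that misses it is
  excluded by \<open>centralizer_condition_coset\<close>. As there are finitely many cosets, the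
  subgroups found for them can be intersected.\<close>

lemma centralizer_condition:
  assumes A: "group A" and hcs: "hereditarily_conjugacy_separable C A"
    and K: "open_normal C A K" and x: "x \<in> carrier A"
  obtains L where "open_normal C A L"
    "\<And>g. \<lbrakk>g \<in> carrier A; g \<otimes>\<^bsub>A\<^esub> x \<otimes>\<^bsub>A\<^esub> inv\<^bsub>A\<^esub> g \<otimes>\<^bsub>A\<^esub> inv\<^bsub>A\<^esub> x \<in> L\<rbrakk>
       \<Longrightarrow> \<exists>c\<in>centralizer A x. \<exists>k\<in>K. g = c \<otimes>\<^bsub>A\<^esub> k"
proof -
  interpret K: normal K A
    using K by (rule open_normal_normal)
  let ?R = "rcosets\<^bsub>A\<^esub> K"
  have "\<exists>L. open_normal C A L \<and> (\<forall>g\<in>S. g \<otimes>\<^bsub>A\<^esub> x \<otimes>\<^bsub>A\<^esub> inv\<^bsub>A\<^esub> g \<otimes>\<^bsub>A\<^esub> inv\<^bsub>A\<^esub> x \<in> L \<longrightarrow>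
      (\<exists>c\<in>centralizer A x. \<exists>k\<in>K. g = c \<otimes>\<^bsub>A\<^esub> k))" if S: "S \<in> ?R" for S
  proof -
    obtain z where z: "z \<in> carrier A" and Sz: "S = K #>\<^bsub>A\<^esub> z"
      using S by (auto simp: RCOSETS_def)
    show ?thesis
    proof (cases "S \<inter> centralizer A x = {}")
      case True
      obtain L where "open_normal C A L"
        "\<And>g. g \<in> K #>\<^bsub>A\<^esub> z \<Longrightarrow> g \<otimes>\<^bsub>A\<^esub> x \<otimes>\<^bsub>A\<^esub> inv\<^bsub>A\<^esub> g \<otimes>\<^bsub>A\<^esub> inv\<^bsub>A\<^esub> x \<notin> L"
        by (rule centralizer_condition_coset[OF A hcs K x z True[unfolded Sz]], rule that)
      then show ?thesis
        unfolding Sz by blast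
    next
      case False
      then obtain c where c: "c \<in> S" "c \<in> centralizer A x" by blast
      have "\<exists>k\<in>K. g = c \<otimes>\<^bsub>A\<^esub> k" if g: "g \<in> S" for g
      proof -
        have S': "S = z <#\<^bsub>A\<^esub> K"
          using Sz z K.coset_eq by simp
        obtain k l where kl: "k \<in> K" "l \<in> K" "g = z \<otimes>\<^bsub>A\<^esub> k" "c = z \<otimes>\<^bsub>A\<^esub> l"
          using g c unfolding S' l_coset_def by blast
        then have "g = c \<otimes>\<^bsub>A\<^esub> (inv\<^bsub>A\<^esub> l \<otimes>\<^bsub>A\<^esub> k)"
          using z by (simp add: K.word_simps)
        then show ?thesis
          using kl by blast
      qed
      then show ?thesis
        using K c by blast
    qed
  qed
  then obtain L where L: "\<And>S. S \<in> ?R \<Longrightarrow> open_normal C A (L S)"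
    and LS: "\<And>S g. \<lbrakk>S \<in> ?R; g \<in> S; g \<otimes>\<^bsub>A\<^esub> x \<otimes>\<^bsub>A\<^esub> inv\<^bsub>A\<^esub> g \<otimes>\<^bsub>A\<^esub> inv\<^bsub>A\<^esub> x \<in> L S\<rbrakk> \<Longrightarrow>
      \<exists>c\<in>centralizer A x. \<exists>k\<in>K. g = c \<otimes>\<^bsub>A\<^esub> k"
    by metis
  have "?R \<noteq> {}"
    using x by (auto simp: RCOSETS_def)
  then have "open_normal C A (\<Inter>(L ` ?R))"
    using L open_normal_finite_rcosets[OF pseudovariety K]
    by (intro open_normal_Inter[OF pseudovariety]) auto
  moreover have "\<exists>c\<in>centralizer A x. \<exists>k\<in>K. g = c \<otimes>\<^bsub>A\<^esub> k"
    if g: "g \<in> carrier A" "g \<otimes>\<^bsub>A\<^esub> x \<otimes>\<^bsub>A\<^esub> inv\<^bsub>A\<^esub> g \<otimes>\<^bsub>A\<^esub> inv\<^bsub>A\<^esub> x \<in> \<Inter>(L ` ?R)" for g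
    using g LS[of "K #>\<^bsub>A\<^esub> g" g] K.rcos_self[OF g(1) K.is_subgroup] K.rcosetsI[OF K.subset g(1)] by blast
  ultimately show thesis
    using that by blast
qed

end

section \<open>Cyclic centralizers as finite unions of cosets\<close>

lemma (in group) centralizer_subgroup:
  assumes "x \<in> carrier G" shows "subgroup (centralizer G x) G"
proof (rule subgroupI)
  fix a b assume ab: "a \<in> centralizer G x" "b \<in> centralizer G x"
  then show "a \<otimes> b \<in> centralizer G x"
    using assms by (auto simp: centralizer_def) (metis m_assoc)
  show "inv a \<in> centralizer G x"
    using ab assms by (auto simp: centralizer_def) (metis inv_closed inv_solve_left inv_solve_right m_assoc m_closed)
qed (use assms in \<open>auto simp: centralizer_def\<close>)

text \<open>If \<open>c\<close> generates the centralizer, then \<open>x\<close> is the power of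
  \<open>c\<close> with some exponent \<open>k\<close>, nonzero because \<open>x\<close> is
  nontrivial. Division with remainder by \<open>k\<close> splits any power of \<open>c\<close> into
  one of finitely many remainders and a power of \<open>x\<close>.\<close>

lemma (in group) centralizer_finite_over_powers:
  assumes "cyclic_centralizers G" "x \<in> carrier G" "x \<noteq> \<one>"
  obtains T where "finite T" "T \<subseteq> centralizer G x"
    "\<And>c. c \<in> centralizer G x \<Longrightarrow> \<exists>t\<in>T. \<exists>n::int. c = t \<otimes> x [^] n"
proof -
  let ?Z = "centralizer G x"
  have Z: "subgroup ?Z G"
    using assms by (intro centralizer_subgroup)
  interpret Z: group "G\<lparr>carrier := ?Z\<rparr>"
    by (rule subgroup_imp_group[OF Z])
  have "cyclic_group (G\<lparr>carrier := ?Z\<rparr>)"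
    using assms by (simp add: cyclic_centralizers_def)
  then obtain c where c: "c \<in> ?Z" and Zc: "?Z = range (\<lambda>n::int. c [^]\<^bsub>G\<lparr>carrier := ?Z\<rparr>\<^esub> n)"
    unfolding Z.cyclic_group by auto
  have Z_eq: "?Z = range (\<lambda>n::int. c [^] n)"
    unfolding int_pow_consistent[OF Z c] by (rule Zc)
  have cG: "c \<in> carrier G"
    using c by (simp add: centralizer_def)
  have "x \<in> ?Z"
    using assms by (simp add: centralizer_def)
  then obtain k :: int where k: "x = c [^] k"
    unfolding Z_eq by blast
  then have k0: "k \<noteq> 0"
    using assms by auto
  \<comment> \<open>The interval is symmetric because \<open>m mod k\<close> takes the sign of
    \<open>k\<close>.\<close>
  let ?T = "(\<lambda>n::int. c [^] n) ` {-\<bar>k\<bar>..\<bar>k\<bar>}"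
  have "\<exists>t\<in>?T. \<exists>n::int. a = t \<otimes> x [^] n" if a: "a \<in> ?Z" for a
  proof -
    obtain m :: int where m: "a = c [^] m"
      using a unfolding Z_eq by blast
    have "m mod k \<in> {-\<bar>k\<bar>..\<bar>k\<bar>}"
      using k0 abs_mod_less[of k m] by auto
    moreover have "a = c [^] (m mod k) \<otimes> x [^] (m div k)"
      unfolding k m using cG by (simp add: int_pow_pow int_pow_mult[symmetric])
    ultimately show ?thesis
      by blast
  qed
  then show thesis
    using Z_eq by (intro that[of ?T]) auto
qed

section \<open>Subdirect products\<close>

lemma (in group) conj_eq_iff_centralizer:
  assumes "x \<in> carrier G" "f \<in> carrier G" "g \<in> carrier G"
  shows "inv f \<otimes> g \<in> centralizer G x \<longleftrightarrow> g \<otimes> x \<otimes> inv g = f \<otimes> x \<otimes> inv f"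
proof
  assume "inv f \<otimes> g \<in> centralizer G x"
  then have "inv f \<otimes> (g \<otimes> x) = x \<otimes> (inv f \<otimes> g)"
    using assms by (simp add: centralizer_def m_assoc)
  then have "f \<otimes> (inv f \<otimes> (g \<otimes> x)) \<otimes> inv g = f \<otimes> (x \<otimes> (inv f \<otimes> g)) \<otimes> inv g"
    by simp
  then show "g \<otimes> x \<otimes> inv g = f \<otimes> x \<otimes> inv f"
    using assms by (simp add: word_simps)
next
  assume "g \<otimes> x \<otimes> inv g = f \<otimes> x \<otimes> inv f"
  then have "inv f \<otimes> (g \<otimes> x \<otimes> inv g) \<otimes> g = inv f \<otimes> (f \<otimes> x \<otimes> inv f) \<otimes> g"
    by simp
  then show "inv f \<otimes> g \<in> centralizer G x"
    using assms by (simp add: centralizer_def word_simps)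
qed

text \<open>Conjugates the assumed element by the inverse of \<open>f\<close>. This reduces a
  comparison with a conjugate of \<open>x\<close> to a comparison with \<open>x\<close> itself, the
  form used in \<open>centralizer_condition\<close>.\<close>

lemma (in normal) conj_diff_mem:
  assumes "x \<in> carrier G" "f \<in> carrier G" "g \<in> carrier G"
    and "g \<otimes> x \<otimes> inv g \<otimes> inv (f \<otimes> x \<otimes> inv f) \<in> H"
  shows "(inv f \<otimes> g) \<otimes> x \<otimes> inv (inv f \<otimes> g) \<otimes> inv x \<in> H"
proof -
  have "inv f \<otimes> (g \<otimes> x \<otimes> inv g \<otimes> inv (f \<otimes> x \<otimes> inv f)) \<otimes> f \<in> H"
    using assms by (intro inv_op_closed1)
  then show ?thesis
    using assms by (simp add: word_simps)
qed

lemma subdirect_product_carrier: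
  assumes "subdirect_product G F1 F2" "(a, b) \<in> G"
  shows "a \<in> carrier F1" "b \<in> carrier F2"
  using assms by (force simp: subdirect_product_def)+

lemma subdirect_product_mult:
  assumes "subdirect_product G F1 F2" "(a, b) \<in> G" "(c, d) \<in> G"
  shows "(a \<otimes>\<^bsub>F1\<^esub> c, b \<otimes>\<^bsub>F2\<^esub> d) \<in> G"
  using assms subgroup.m_closed[of G "F1 \<times>\<times> F2" "(a, b)" "(c, d)"]
  by (simp add: subdirect_product_def)

lemma subdirect_product_inv:
  assumes "subdirect_product G F1 F2" "group F1" "group F2" "(a, b) \<in> G"
  shows "(inv\<^bsub>F1\<^esub> a, inv\<^bsub>F2\<^esub> b) \<in> G"
  using assms subgroup.m_inv_closed[of G "F1 \<times>\<times> F2" "(a, b)"]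
    inv_DirProd subdirect_product_carrier[OF assms(1,4)]
  by (simp add: subdirect_product_def)

context
  fixes C :: group_class
  assumes pseudovariety: "pseudovariety_of_finite_groups C" and ext: "extension_closed C"
begin

text \<open>The core case. The assumption \<open>nc\<close> says that no element of \<open>G\<close>
  conjugates \<open>(x1, x2)\<close> to the pair of \<open>x1\<close> and the conjugate of
  \<open>x2\<close> by \<open>f\<close>; the conclusion says the same modulo \<open>L1\<close> and
  \<open>L2\<close>.\<close>

lemma subdirect_product_separation:
  assumes F1: "group F1" and F2: "group F2" and C: "C \<noteq> {}"
    and hcs1: "hereditarily_conjugacy_separable C F1"
    and hcs2: "hereditarily_conjugacy_separable C F2"
    and cyc1: "cyclic_centralizers F1" and cyc2: "cyclic_centralizers F2"
    and subdirect: "subdirect_product G F1 F2"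
    and N1: "N1 = {x \<in> carrier F1. (x, \<one>\<^bsub>F2\<^esub>) \<in> G}"
    and sep: "cyclic_subgroup_separable C (F1 Mod N1)"
    and x: "(x1, x2) \<in> G" "x1 \<noteq> \<one>\<^bsub>F1\<^esub>" "x2 \<noteq> \<one>\<^bsub>F2\<^esub>" and f: "f \<in> carrier F2"
    and nc: "\<And>g1 g2. \<lbrakk>(g1, g2) \<in> G; g1 \<in> centralizer F1 x1\<rbrakk>
      \<Longrightarrow> inv\<^bsub>F2\<^esub> f \<otimes>\<^bsub>F2\<^esub> g2 \<notin> centralizer F2 x2"
  obtains L1 L2 where "open_normal C F1 L1" "open_normal C F2 L2"
    "\<And>g1 g2. \<lbrakk>(g1, g2) \<in> G; g1 \<otimes>\<^bsub>F1\<^esub> x1 \<otimes>\<^bsub>F1\<^esub> inv\<^bsub>F1\<^esub> g1 \<otimes>\<^bsub>F1\<^esub> inv\<^bsub>F1\<^esub> x1 \<in> L1\<rbrakk> \<Longrightarrow>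
      (inv\<^bsub>F2\<^esub> f \<otimes>\<^bsub>F2\<^esub> g2) \<otimes>\<^bsub>F2\<^esub> x2 \<otimes>\<^bsub>F2\<^esub> inv\<^bsub>F2\<^esub> (inv\<^bsub>F2\<^esub> f \<otimes>\<^bsub>F2\<^esub> g2) \<otimes>\<^bsub>F2\<^esub> inv\<^bsub>F2\<^esub> x2 \<notin> L2"
proof -
  interpret F1: group F1 by fact
  interpret F2: group F2 by fact
  interpret D: group "F1 \<times>\<times> F2"
    using F1 F2 by (rule DirProd_group)
  have G: "subgroup G (F1 \<times>\<times> F2)" and fst: "fst ` G = carrier F1" and snd: "snd ` G = carrier F2"
    using subdirect by (simp_all add: subdirect_product_def)
  note Gc = subdirect_product_carrier[OF subdirect]
    and Gm = subdirect_product_mult[OF subdirect]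
    and Gi = subdirect_product_inv[OF subdirect F1 F2]
  have Gp: "(x1 [^]\<^bsub>F1\<^esub> n, x2 [^]\<^bsub>F2\<^esub> n) \<in> G" for n :: int
  proof -
    let ?p = "(x1, x2) [^]\<^bsub>F1 \<times>\<times> F2\<^esub> n"
    have "(x1, x2) \<in> carrier (F1 \<times>\<times> F2)" "fst \<in> hom (F1 \<times>\<times> F2) F1" "snd \<in> hom (F1 \<times>\<times> F2) F2"
      using Gc[OF x(1)] by (auto simp: hom_def)
    then have "fst ?p = x1 [^]\<^bsub>F1\<^esub> n" "snd ?p = x2 [^]\<^bsub>F2\<^esub> n"
      using F1 F2 D.group_axioms by (simp_all add: hom_int_pow)
    moreover have "?p \<in> G"
      by (rule D.subgroup_int_pow_closed[OF G x(1)])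
    ultimately show ?thesis
      by (metis prod.collapse)
  qed
  have x1: "x1 \<in> carrier F1" and x2: "x2 \<in> carrier F2"
    using Gc x(1) by auto
  have N1G: "(a, \<one>\<^bsub>F2\<^esub>) \<in> G" if "a \<in> N1" for a
    using that N1 by simp
  \<comment> \<open>Elements of \<open>F1\<close> paired in \<open>G\<close> with the same
    \<open>b\<close> agree modulo \<open>N1\<close>; this makes the map \<open>\<pi>\<^sub>2\<close>
    from \<open>F2\<close> to F1/N1 well defined.\<close>
  have diff: "inv\<^bsub>F1\<^esub> a \<otimes>\<^bsub>F1\<^esub> a' \<in> N1" if "(a, b) \<in> G" "(a', b) \<in> G" for a a' b
    using Gm[OF Gi[OF that(1)] that(2)] Gc that by (simp add: N1)
  have "N1 \<lhd> F1"
  proof (rule F1.normal_invI[OF F1.subgroupI])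
    show "N1 \<noteq> {}"
      using subgroup.one_closed[OF G] N1 by auto
    fix a assume a: "a \<in> N1"
    show "inv\<^bsub>F1\<^esub> a \<in> N1"
      using Gi[OF N1G[OF a]] Gc by (simp add: N1)
    show "a \<otimes>\<^bsub>F1\<^esub> b \<in> N1" if b: "b \<in> N1" for b
      using Gm[OF N1G[OF a] N1G[OF b]] Gc by (simp add: N1)
  next
    fix a h assume a: "a \<in> carrier F1" and h: "h \<in> N1"
    obtain b where b: "(a, b) \<in> G"
      using a fst by force
    show "a \<otimes>\<^bsub>F1\<^esub> h \<otimes>\<^bsub>F1\<^esub> inv\<^bsub>F1\<^esub> a \<in> N1"
      using Gm[OF Gm[OF b N1G[OF h]] Gi[OF b]] Gc b by (simp add: N1)
  qed (simp add: N1)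
  then interpret N1: normal N1 F1 .
  \<comment> \<open>A representative in \<open>F1\<close> of \<open>\<pi>\<^sub>2(b)\<close>. It is
    multiplicative only modulo \<open>N1\<close>.\<close>
  define lift where "lift b = (SOME a. (a, b) \<in> G)" for b
  have lift: "(lift b, b) \<in> G" if b: "b \<in> carrier F2" for b
  proof -
    have "b \<in> snd ` G"
      using b snd by simp
    then have "\<exists>a. (a, b) \<in> G"
      by auto
    then show ?thesis
      unfolding lift_def by (rule someI_ex)
  qed
  have lift_carrier: "lift b \<in> carrier F1" if "b \<in> carrier F2" for b
    using Gc lift[OF that] by blast
  obtain T1 where T1: "finite T1" "T1 \<subseteq> centralizer F1 x1"
    "\<And>c. c \<in> centralizer F1 x1 \<Longrightarrow> \<exists>t\<in>T1. \<exists>n::int. c = t \<otimes>\<^bsub>F1\<^esub> x1 [^]\<^bsub>F1\<^esub> n"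
    using F1.centralizer_finite_over_powers[OF cyc1 x1 x(2)] by blast
  obtain T2 where T2: "finite T2" "T2 \<subseteq> centralizer F2 x2"
    "\<And>c. c \<in> centralizer F2 x2 \<Longrightarrow> \<exists>t\<in>T2. \<exists>n::int. c = t \<otimes>\<^bsub>F2\<^esub> x2 [^]\<^bsub>F2\<^esub> n"
    using F2.centralizer_finite_over_powers[OF cyc2 x2 x(3)] by blast
  have T1c: "s \<in> carrier F1" if "s \<in> T1" for s
    using that T1 by (auto simp: centralizer_def)
  have T2c: "t \<in> carrier F2" if "t \<in> T2" for t
    using that T2 by (auto simp: centralizer_def)
  \<comment> \<open>The image of \<open>u s t\<close> in \<open>Q\<close> is \<open>\<pi>\<^sub>1(s)\<close>-inverse times \<open>\<pi>\<^sub>2(f t)\<close>. As \<open>\<pi>\<^sub>2(t)\<close> commutes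
    with \<open>q\<close>, this lies in \<open>\<langle>q\<rangle>\<close> iff \<open>\<pi>\<^sub>2(f)\<close> lies in \<open>\<pi>\<^sub>1(s) \<langle>q\<rangle> \<pi>\<^sub>2(t)\<close>-inverse.\<close>
  define u where "u s t = inv\<^bsub>F1\<^esub> s \<otimes>\<^bsub>F1\<^esub> (lift f \<otimes>\<^bsub>F1\<^esub> lift t)" for s t
  have "\<exists>K. open_normal C F1 K \<and> N1 \<subseteq> K \<and> (\<forall>n::int. \<forall>k\<in>K. u s t \<noteq> x1 [^]\<^bsub>F1\<^esub> n \<otimes>\<^bsub>F1\<^esub> k)"
    if s: "s \<in> T1" and t: "t \<in> T2" for s t
  proof -
    have sc: "s \<in> carrier F1" and tc: "t \<in> carrier F2"
      using s t T1c T2c by auto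
    have uc: "u s t \<in> carrier F1"
      using sc tc f by (simp add: u_def lift_carrier)
    have "u s t \<noteq> x1 [^]\<^bsub>F1\<^esub> n \<otimes>\<^bsub>F1\<^esub> a" if a: "a \<in> N1" for n :: int and a
    proof
      assume "u s t = x1 [^]\<^bsub>F1\<^esub> n \<otimes>\<^bsub>F1\<^esub> a"
      then have "s \<otimes>\<^bsub>F1\<^esub> u s t \<otimes>\<^bsub>F1\<^esub> inv\<^bsub>F1\<^esub> a = s \<otimes>\<^bsub>F1\<^esub> (x1 [^]\<^bsub>F1\<^esub> n \<otimes>\<^bsub>F1\<^esub> a) \<otimes>\<^bsub>F1\<^esub> inv\<^bsub>F1\<^esub> a"
        by simp
      then have eq: "lift f \<otimes>\<^bsub>F1\<^esub> lift t \<otimes>\<^bsub>F1\<^esub> inv\<^bsub>F1\<^esub> a = s \<otimes>\<^bsub>F1\<^esub> x1 [^]\<^bsub>F1\<^esub> n"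
        using sc tc f x1 a by (simp add: u_def lift_carrier F1.word_simps)
      \<comment> \<open>This element of \<open>G\<close> contradicts \<open>nc\<close>: by
        \<open>eq\<close> its first coordinate centralizes \<open>x1\<close>, and its second is
        \<open>f\<close> times \<open>t\<close>, where \<open>t\<close> centralizes
        \<open>x2\<close>.\<close>
      have "(lift f \<otimes>\<^bsub>F1\<^esub> lift t \<otimes>\<^bsub>F1\<^esub> inv\<^bsub>F1\<^esub> a, f \<otimes>\<^bsub>F2\<^esub> t \<otimes>\<^bsub>F2\<^esub> inv\<^bsub>F2\<^esub> \<one>\<^bsub>F2\<^esub>) \<in> G"
        using f tc a by (intro Gm Gi lift N1G)
      then have "(s \<otimes>\<^bsub>F1\<^esub> x1 [^]\<^bsub>F1\<^esub> n, f \<otimes>\<^bsub>F2\<^esub> t) \<in> G"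
        using f tc by (simp add: eq)
      moreover have "s \<otimes>\<^bsub>F1\<^esub> x1 [^]\<^bsub>F1\<^esub> n \<in> centralizer F1 x1"
      proof -
        have Z: "subgroup (centralizer F1 x1) F1"
          by (rule F1.centralizer_subgroup[OF x1])
        have "x1 \<in> centralizer F1 x1"
          using x1 by (simp add: centralizer_def)
        then show ?thesis
          using s T1(2) F1.subgroup_int_pow_closed[OF Z] subgroup.m_closed[OF Z] by blast
      qed
      ultimately have "inv\<^bsub>F2\<^esub> f \<otimes>\<^bsub>F2\<^esub> (f \<otimes>\<^bsub>F2\<^esub> t) \<notin> centralizer F2 x2"
        by (rule nc)
      then show False
        using f tc t T2(2) by (auto simp: F2.word_simps)
    qed
    then show ?thesis
      using cyclic_subgroup_separable_quotient[OF pseudovariety F1 C N1.normal_axioms sep x1 uc]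
      by metis
  qed
  then obtain K0 where K0: "\<And>s t. \<lbrakk>s \<in> T1; t \<in> T2\<rbrakk> \<Longrightarrow> open_normal C F1 (K0 s t)"
      "\<And>s t. \<lbrakk>s \<in> T1; t \<in> T2\<rbrakk> \<Longrightarrow> N1 \<subseteq> K0 s t"
      "\<And>s t n k. \<lbrakk>s \<in> T1; t \<in> T2; k \<in> K0 s t\<rbrakk> \<Longrightarrow> u s t \<noteq> x1 [^]\<^bsub>F1\<^esub> (n::int) \<otimes>\<^bsub>F1\<^esub> k"
    by metis
  \<comment> \<open>Inserting \<open>carrier F1\<close> makes it immediate that the family is
    nonempty.\<close>
  define \<K> where "\<K> = insert (carrier F1) ((\<lambda>(s, t). K0 s t) ` (T1 \<times> T2))"
  define K where "K = \<Inter>\<K>"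
  have K: "open_normal C F1 K"
    unfolding K_def
  proof (rule open_normal_Inter[OF pseudovariety])
    show "finite \<K>" "\<K> \<noteq> {}"
      using T1(1) T2(1) by (simp_all add: \<K>_def)
    show "open_normal C F1 M" if "M \<in> \<K>" for M
      using that K0(1) open_normal_carrier[OF pseudovariety C F1] by (auto simp: \<K>_def)
  qed
  have NK: "N1 \<subseteq> K"
    using K0(2) N1.subset by (auto simp: K_def \<K>_def)
  have uK: "u s t \<noteq> x1 [^]\<^bsub>F1\<^esub> n \<otimes>\<^bsub>F1\<^esub> k" if "s \<in> T1" "t \<in> T2" "k \<in> K" for s t k and n :: int
  proof -
    have "k \<in> K0 s t"
      using that by (auto simp: K_def \<K>_def)
    then show ?thesis
      using K0(3) that by blast
  qed
  interpret K: normal K F1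
    using K by (rule open_normal_normal)
  \<comment> \<open>The composite of \<open>\<pi>\<^sub>2\<close> with the projection of F1/N1 onto
    F1/K; it is a homomorphism because \<open>K\<close> contains \<open>N1\<close>. Its kernel
    \<open>K2\<close> is the counterpart of \<open>K\<close> in \<open>F2\<close>.\<close>
  define q where "q b = K #>\<^bsub>F1\<^esub> lift b" for b
  have q: "q \<in> hom F2 (F1 Mod K)"
  proof (rule homI)
    fix b assume b: "b \<in> carrier F2"
    then show "q b \<in> carrier (F1 Mod K)"
      by (simp add: q_def carrier_FactGroup lift_carrier)
    fix c assume c: "c \<in> carrier F2"
    have bc: "lift b \<otimes>\<^bsub>F1\<^esub> lift c \<in> carrier F1" "lift (b \<otimes>\<^bsub>F2\<^esub> c) \<in> carrier F1"
      using b c lift_carrier by auto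
    have "inv\<^bsub>F1\<^esub> (lift b \<otimes>\<^bsub>F1\<^esub> lift c) \<otimes>\<^bsub>F1\<^esub> lift (b \<otimes>\<^bsub>F2\<^esub> c) \<in> K"
      using diff[OF Gm[OF lift[OF b] lift[OF c]] lift] b c NK by auto
    then have "lift (b \<otimes>\<^bsub>F2\<^esub> c) \<in> (lift b \<otimes>\<^bsub>F1\<^esub> lift c) <#\<^bsub>F1\<^esub> K"
      using bc by (force simp: l_coset_def F1.word_simps intro!: bexI)
    then have "lift (b \<otimes>\<^bsub>F2\<^esub> c) \<in> K #>\<^bsub>F1\<^esub> (lift b \<otimes>\<^bsub>F1\<^esub> lift c)"
      using bc K.coset_eq by simp
    then have "K #>\<^bsub>F1\<^esub> (lift b \<otimes>\<^bsub>F1\<^esub> lift c) = K #>\<^bsub>F1\<^esub> lift (b \<otimes>\<^bsub>F2\<^esub> c)"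
      using F1.repr_independence[OF _ bc(1) K.is_subgroup] by blast
    then show "q (b \<otimes>\<^bsub>F2\<^esub> c) = q b \<otimes>\<^bsub>F1 Mod K\<^esub> q c"
      using b c by (simp add: q_def lift_carrier K.rcos_sum)
  qed
  define K2 where "K2 = kernel F2 (F1 Mod K) q"
  have K2: "open_normal C F2 K2"
    unfolding K2_def using open_normal_kernel[OF pseudovariety F2 q] K by (simp add: open_normal_def)
  have K2_lift: "b \<in> carrier F2" "lift b \<in> K" if "b \<in> K2" for b
  proof -
    show b: "b \<in> carrier F2"
      using that by (simp add: K2_def kernel_def)
    show "lift b \<in> K"
      using that F1.r_coset_eq_subgroup_iff[OF K.is_subgroup lift_carrier[OF b]]
      by (simp add: K2_def kernel_def q_def)
  qed
  obtain L1 where L1: "open_normal C F1 L1"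
    "\<And>g. \<lbrakk>g \<in> carrier F1; g \<otimes>\<^bsub>F1\<^esub> x1 \<otimes>\<^bsub>F1\<^esub> inv\<^bsub>F1\<^esub> g \<otimes>\<^bsub>F1\<^esub> inv\<^bsub>F1\<^esub> x1 \<in> L1\<rbrakk>
       \<Longrightarrow> \<exists>c\<in>centralizer F1 x1. \<exists>k\<in>K. g = c \<otimes>\<^bsub>F1\<^esub> k"
    by (rule centralizer_condition[OF pseudovariety ext F1 hcs1 K x1], rule that)
  obtain L2 where L2: "open_normal C F2 L2"
    "\<And>g. \<lbrakk>g \<in> carrier F2; g \<otimes>\<^bsub>F2\<^esub> x2 \<otimes>\<^bsub>F2\<^esub> inv\<^bsub>F2\<^esub> g \<otimes>\<^bsub>F2\<^esub> inv\<^bsub>F2\<^esub> x2 \<in> L2\<rbrakk>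
       \<Longrightarrow> \<exists>c\<in>centralizer F2 x2. \<exists>k\<in>K2. g = c \<otimes>\<^bsub>F2\<^esub> k"
    by (rule centralizer_condition[OF pseudovariety ext F2 hcs2 K2 x2], rule that)
  have False
    if g: "(g1, g2) \<in> G" and g1: "g1 \<otimes>\<^bsub>F1\<^esub> x1 \<otimes>\<^bsub>F1\<^esub> inv\<^bsub>F1\<^esub> g1 \<otimes>\<^bsub>F1\<^esub> inv\<^bsub>F1\<^esub> x1 \<in> L1"
      and g2: "(inv\<^bsub>F2\<^esub> f \<otimes>\<^bsub>F2\<^esub> g2) \<otimes>\<^bsub>F2\<^esub> x2 \<otimes>\<^bsub>F2\<^esub> inv\<^bsub>F2\<^esub> (inv\<^bsub>F2\<^esub> f \<otimes>\<^bsub>F2\<^esub> g2) \<otimes>\<^bsub>F2\<^esub> inv\<^bsub>F2\<^esub> x2 \<in> L2"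
    for g1 g2
  proof -
    have gc: "g1 \<in> carrier F1" "g2 \<in> carrier F2"
      using Gc[OF g] by auto
    obtain c1 k1 where c1: "c1 \<in> centralizer F1 x1" and k1: "k1 \<in> K" and g1_eq: "g1 = c1 \<otimes>\<^bsub>F1\<^esub> k1"
      using L1(2)[OF gc(1) g1] by blast
    obtain s and n :: int where s: "s \<in> T1" and c1_eq: "c1 = s \<otimes>\<^bsub>F1\<^esub> x1 [^]\<^bsub>F1\<^esub> n"
      using T1(3)[OF c1] by blast
    have "inv\<^bsub>F2\<^esub> f \<otimes>\<^bsub>F2\<^esub> g2 \<in> carrier F2"
      using gc f by simp
    from L2(2)[OF this g2] obtain c2 k2 where c2: "c2 \<in> centralizer F2 x2" and k2: "k2 \<in> K2"
      and "inv\<^bsub>F2\<^esub> f \<otimes>\<^bsub>F2\<^esub> g2 = c2 \<otimes>\<^bsub>F2\<^esub> k2"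
      by blast
    then have g2_eq: "g2 = f \<otimes>\<^bsub>F2\<^esub> (c2 \<otimes>\<^bsub>F2\<^esub> k2)"
      using f gc F2.mult_inv_cancel_left(1) by metis
    obtain t and m :: int where t: "t \<in> T2" and c2_eq: "c2 = t \<otimes>\<^bsub>F2\<^esub> x2 [^]\<^bsub>F2\<^esub> m"
      using T2(3)[OF c2] by blast
    note k2c = K2_lift(1)[OF k2]
    have sc: "s \<in> carrier F1" and tc: "t \<in> carrier F2"
      using s t T1c T2c by auto
    have k1c: "k1 \<in> carrier F1"
      using k1 by simp
    \<comment> \<open>A lift of \<open>g2\<close> to \<open>F1\<close>, factor by factor. The power
      of \<open>x2\<close> is lifted to the same power of \<open>x1\<close>, so that it can be
      merged with the power of \<open>x1\<close> in \<open>g1\<close>. Since \<open>?w\<close> and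
      \<open>g1\<close> are both paired with \<open>g2\<close>, they differ by an element of
      \<open>N1\<close>.\<close>
    let ?w = "lift f \<otimes>\<^bsub>F1\<^esub> (lift t \<otimes>\<^bsub>F1\<^esub> x1 [^]\<^bsub>F1\<^esub> m \<otimes>\<^bsub>F1\<^esub> lift k2)"
    define v where "v = inv\<^bsub>F1\<^esub> ?w \<otimes>\<^bsub>F1\<^esub> g1"
    have "(?w, g2) \<in> G"
      unfolding g2_eq c2_eq using f tc k2c by (intro Gm Gp lift)
    then have v: "v \<in> K"
      using diff g NK unfolding v_def by blast
    have vc: "v \<in> carrier F1"
      using v by simp
    note lc = lift_carrier[OF f] lift_carrier[OF tc] lift_carrier[OF k2c]
    have "inv\<^bsub>F1\<^esub> v = inv\<^bsub>F1\<^esub> g1 \<otimes>\<^bsub>F1\<^esub> ?w"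
      using lc x1 gc by (simp add: v_def F1.word_simps)
    then have "x1 [^]\<^bsub>F1\<^esub> n \<otimes>\<^bsub>F1\<^esub> k1 \<otimes>\<^bsub>F1\<^esub> inv\<^bsub>F1\<^esub> v \<otimes>\<^bsub>F1\<^esub> inv\<^bsub>F1\<^esub> lift k2 \<otimes>\<^bsub>F1\<^esub> inv\<^bsub>F1\<^esub> (x1 [^]\<^bsub>F1\<^esub> m) = u s t"
      using lc x1 sc k1c unfolding g1_eq c1_eq by (simp add: u_def F1.word_simps)
    moreover have "x1 [^]\<^bsub>F1\<^esub> n = x1 [^]\<^bsub>F1\<^esub> (n - m) \<otimes>\<^bsub>F1\<^esub> x1 [^]\<^bsub>F1\<^esub> m"
      using x1 by (simp flip: F1.int_pow_mult)
    \<comment> \<open>Splitting off the power with exponent \<open>n - m\<close> leaves a conjugate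
      of an element of \<open>K\<close>, which lies in \<open>K\<close> by normality; this
      contradicts the choice of \<open>K\<close>.\<close>
    ultimately have "u s t = x1 [^]\<^bsub>F1\<^esub> (n - m) \<otimes>\<^bsub>F1\<^esub>
        (x1 [^]\<^bsub>F1\<^esub> m \<otimes>\<^bsub>F1\<^esub> (k1 \<otimes>\<^bsub>F1\<^esub> inv\<^bsub>F1\<^esub> v \<otimes>\<^bsub>F1\<^esub> inv\<^bsub>F1\<^esub> lift k2) \<otimes>\<^bsub>F1\<^esub> inv\<^bsub>F1\<^esub> (x1 [^]\<^bsub>F1\<^esub> m))"
      using lc x1 k1c vc by (simp add: F1.m_assoc)
    moreover have "x1 [^]\<^bsub>F1\<^esub> m \<otimes>\<^bsub>F1\<^esub> (k1 \<otimes>\<^bsub>F1\<^esub> inv\<^bsub>F1\<^esub> v \<otimes>\<^bsub>F1\<^esub> inv\<^bsub>F1\<^esub> lift k2) \<otimes>\<^bsub>F1\<^esub> inv\<^bsub>F1\<^esub> (x1 [^]\<^bsub>F1\<^esub> m) \<in> K"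
      using x1 k1 v K2_lift(2)[OF k2]
      by (intro K.inv_op_closed2 subgroup.m_closed[OF K.is_subgroup] subgroup.m_inv_closed[OF K.is_subgroup]) auto
    ultimately show False
      using uK[OF s t] by blast
  qed
  then show thesis
    using that[OF L1(1) L2(1)] by blast
qed

end

section \<open>Conjugacy separability of subdirect products\<close>

lemma hereditarily_conjugacy_separable_imp:
  assumes "hereditarily_conjugacy_separable C A" "group A"
  shows "conjugacy_separable C A"
proof -
  \<comment> \<open>The whole group is among the generators of \<open>pro_topology\<close>, so this
    holds even for empty \<open>C\<close>.\<close>
  have "openin (pro_topology C A) (carrier A)"
    unfolding pro_topology_def by (intro topology_generated_by_Basis) simp
  moreover have "A\<lparr>carrier := carrier A\<rparr> = A"
    by simp
  ultimately show ?thesis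
    using assms group.subgroup_self unfolding hereditarily_conjugacy_separable_def by metis
qed

theorem proposition4p5:
  fixes C :: group_class
    and F1 :: "('a, 'c) monoid_scheme" and F2 :: "('b, 'd) monoid_scheme"
    and G :: "('a \<times> 'b) set" and N1 :: "'a set"
  assumes "pseudovariety_of_finite_groups C" and "extension_closed C"
    and "group F1" and "group F2"
    and "hereditarily_conjugacy_separable C F1" and "hereditarily_conjugacy_separable C F2"
    and "cyclic_centralizers F1" and "cyclic_centralizers F2"
    and "subdirect_product G F1 F2"
    and "N1 = {x \<in> carrier F1. (x, \<one>\<^bsub>F2\<^esub>) \<in> G}"
    and "cyclic_subgroup_separable C (F1 Mod N1)"
  shows "conjugacy_separable C ((F1 \<times>\<times> F2)\<lparr>carrier := G\<rparr>)"
proof -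
  interpret F1: group F1 by fact
  interpret F2: group F2 by fact
  interpret D: group "F1 \<times>\<times> F2"
    using assms(3,4) by (rule DirProd_group)
  have G: "subgroup G (F1 \<times>\<times> F2)" and fst: "fst ` G = carrier F1" and snd: "snd ` G = carrier F2"
    using assms(9) by (simp_all add: subdirect_product_def)
  let ?G = "(F1 \<times>\<times> F2)\<lparr>carrier := G\<rparr>"
  have GG: "group ?G"
    by (rule D.subgroup_imp_group[OF G])
  note Gc = subdirect_product_carrier[OF assms(9)]
    and Gm = subdirect_product_mult[OF assms(9)]
    and Gi = subdirect_product_inv[OF assms(9,3,4)]
  have inv_pair: "inv\<^bsub>?G\<^esub> (a, b) = (inv\<^bsub>F1\<^esub> a, inv\<^bsub>F2\<^esub> b)" if "(a, b) \<in> G" for a b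
    using D.m_inv_consistent[OF G that] inv_DirProd[OF assms(3,4)] Gc[OF that] by simp
  have conjI': "conjugate_in ?G (x1, x2) (g1 \<otimes>\<^bsub>F1\<^esub> x1 \<otimes>\<^bsub>F1\<^esub> inv\<^bsub>F1\<^esub> g1, g2 \<otimes>\<^bsub>F2\<^esub> x2 \<otimes>\<^bsub>F2\<^esub> inv\<^bsub>F2\<^esub> g2)"
    if "(g1, g2) \<in> G" for x1 x2 g1 g2
    unfolding conjugate_in_def using that inv_pair by (intro bexI[of _ "(g1, g2)"]) simp_all
  have fst_hom: "fst \<in> hom ?G F1" and snd_hom: "snd \<in> hom ?G F2"
    using Gc by (auto simp: hom_def)
  have cs1: "conjugacy_separable C F1" and cs2: "conjugacy_separable C F2"
    using assms hereditarily_conjugacy_separable_imp by blast+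
  show ?thesis
    unfolding conjugacy_separable_def
  proof (intro ballI impI)
    fix x y assume "x \<in> carrier ?G" "y \<in> carrier ?G" and nconj: "\<not> conjugate_in ?G x y"
    moreover obtain x1 x2 y1 y2 where x: "x = (x1, x2)" and y: "y = (y1, y2)"
      by fastforce
    ultimately have xG: "(x1, x2) \<in> G" and yG: "(y1, y2) \<in> G"
      by auto
    note xc = Gc[OF xG] and yc = Gc[OF yG]
    show "\<exists>M\<in>C. \<exists>\<phi>\<in>hom ?G M. \<not> conjugate_in M (\<phi> x) (\<phi> y)"
    proof (cases "conjugate_in F1 x1 y1 \<and> conjugate_in F2 x2 y2")
      \<comment> \<open>A homomorphism separating one pair of coordinates is composed with the
        projection of \<open>G\<close> to that factor.\<close>
      case False
      then consider "\<not> conjugate_in F1 x1 y1" | "\<not> conjugate_in F2 x2 y2"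
        by blast
      then show ?thesis
      proof cases
        case 1
        then obtain M \<phi> where "M \<in> C" "\<phi> \<in> hom F1 M" "\<not> conjugate_in M (\<phi> x1) (\<phi> y1)"
          using cs1 xc yc unfolding conjugacy_separable_def by blast
        then show ?thesis
          using Group.hom_compose[OF fst_hom] by (intro bexI[of _ M] bexI[of _ "\<phi> \<circ> fst"]) (auto simp: x y)
      next
        case 2
        then obtain M \<phi> where "M \<in> C" "\<phi> \<in> hom F2 M" "\<not> conjugate_in M (\<phi> x2) (\<phi> y2)"
          using cs2 xc yc unfolding conjugacy_separable_def by blast
        then show ?thesis
          using Group.hom_compose[OF snd_hom] by (intro bexI[of _ M] bexI[of _ "\<phi> \<circ> snd"]) (auto simp: x y)
      qed
    next
      case True
      then obtain f1 f2 where f: "f1 \<in> carrier F1" "f2 \<in> carrier F2"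
        and y1: "y1 = f1 \<otimes>\<^bsub>F1\<^esub> x1 \<otimes>\<^bsub>F1\<^esub> inv\<^bsub>F1\<^esub> f1" and y2: "y2 = f2 \<otimes>\<^bsub>F2\<^esub> x2 \<otimes>\<^bsub>F2\<^esub> inv\<^bsub>F2\<^esub> f2"
        by (auto simp: conjugate_in_def)
      obtain h where h: "(f1, h) \<in> G"
        using f fst by force
      obtain h' where h': "(h', f2) \<in> G"
        using f snd by force
      note hc = Gc[OF h] and hc' = Gc[OF h']
      \<comment> \<open>If \<open>x1\<close> is trivial, any first coordinate fixes it, so
        \<open>(h', f2)\<close> in \<open>G\<close> already conjugates \<open>x\<close> to
        \<open>y\<close>. The case of trivial \<open>x2\<close> is symmetric, with
        \<open>(f1, h)\<close>.\<close>
      have x1_ne: "x1 \<noteq> \<one>\<^bsub>F1\<^esub>"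
      proof
        assume "x1 = \<one>\<^bsub>F1\<^esub>"
        then have "y = (h' \<otimes>\<^bsub>F1\<^esub> x1 \<otimes>\<^bsub>F1\<^esub> inv\<^bsub>F1\<^esub> h', f2 \<otimes>\<^bsub>F2\<^esub> x2 \<otimes>\<^bsub>F2\<^esub> inv\<^bsub>F2\<^esub> f2)"
          using f hc' by (simp add: y y1 y2)
        then show False
          using nconj conjI'[OF h'] x by metis
      qed
      have x2_ne: "x2 \<noteq> \<one>\<^bsub>F2\<^esub>"
      proof
        assume "x2 = \<one>\<^bsub>F2\<^esub>"
        then have "y = (f1 \<otimes>\<^bsub>F1\<^esub> x1 \<otimes>\<^bsub>F1\<^esub> inv\<^bsub>F1\<^esub> f1, h \<otimes>\<^bsub>F2\<^esub> x2 \<otimes>\<^bsub>F2\<^esub> inv\<^bsub>F2\<^esub> h)"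
          using f hc by (simp add: y y1 y2)
        then show False
          using nconj conjI'[OF h] x by metis
      qed
      \<comment> \<open>Separating \<open>x1\<close> from the identity produces a member of
        \<open>C\<close>, so \<open>C\<close> is nonempty.\<close>
      have "\<not> conjugate_in F1 x1 \<one>\<^bsub>F1\<^esub>"
      proof
        assume "conjugate_in F1 x1 \<one>\<^bsub>F1\<^esub>"
        then obtain g where g: "g \<in> carrier F1" "\<one>\<^bsub>F1\<^esub> = g \<otimes>\<^bsub>F1\<^esub> x1 \<otimes>\<^bsub>F1\<^esub> inv\<^bsub>F1\<^esub> g"
          by (auto simp: conjugate_in_def)
        then have "inv\<^bsub>F1\<^esub> g \<otimes>\<^bsub>F1\<^esub> \<one>\<^bsub>F1\<^esub> \<otimes>\<^bsub>F1\<^esub> g = inv\<^bsub>F1\<^esub> g \<otimes>\<^bsub>F1\<^esub> (g \<otimes>\<^bsub>F1\<^esub> x1 \<otimes>\<^bsub>F1\<^esub> inv\<^bsub>F1\<^esub> g) \<otimes>\<^bsub>F1\<^esub> g"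
          by simp
        then show False
          using x1_ne g(1) xc by (simp add: F1.word_simps)
      qed
      then have C: "C \<noteq> {}"
        using cs1 xc F1.one_closed unfolding conjugacy_separable_def by blast
      \<comment> \<open>Conjugating \<open>y\<close> by the inverse of \<open>(f1, h)\<close> makes
        its first coordinate \<open>x1\<close> and its second the conjugate of \<open>x2\<close> by
        \<open>?f\<close>.\<close>
      let ?f = "inv\<^bsub>F2\<^esub> h \<otimes>\<^bsub>F2\<^esub> f2"
      have fc: "?f \<in> carrier F2"
        using hc f by simp
      have f_inv: "inv\<^bsub>F2\<^esub> ?f \<otimes>\<^bsub>F2\<^esub> (inv\<^bsub>F2\<^esub> h \<otimes>\<^bsub>F2\<^esub> g) = inv\<^bsub>F2\<^esub> f2 \<otimes>\<^bsub>F2\<^esub> g" if "g \<in> carrier F2" for g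
        using that hc f by (simp add: F2.word_simps)
      \<comment> \<open>A pair \<open>(g1, g2)\<close> violating this would yield the product of
        \<open>(f1, h)\<close> and \<open>(g1, g2)\<close> as an element of \<open>G\<close>
        conjugating \<open>x\<close> to \<open>y\<close>.\<close>
      have nc: "inv\<^bsub>F2\<^esub> ?f \<otimes>\<^bsub>F2\<^esub> g2 \<notin> centralizer F2 x2"
        if g: "(g1, g2) \<in> G" "g1 \<in> centralizer F1 x1" for g1 g2
      proof
        assume g2: "inv\<^bsub>F2\<^esub> ?f \<otimes>\<^bsub>F2\<^esub> g2 \<in> centralizer F2 x2"
        note gc = Gc[OF g(1)]
        have "inv\<^bsub>F1\<^esub> f1 \<otimes>\<^bsub>F1\<^esub> (f1 \<otimes>\<^bsub>F1\<^esub> g1) \<in> centralizer F1 x1"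
          using g f gc by (simp add: F1.word_simps)
        then have "f1 \<otimes>\<^bsub>F1\<^esub> g1 \<otimes>\<^bsub>F1\<^esub> x1 \<otimes>\<^bsub>F1\<^esub> inv\<^bsub>F1\<^esub> (f1 \<otimes>\<^bsub>F1\<^esub> g1) = y1"
          using F1.conj_eq_iff_centralizer[OF xc(1) f(1)] f gc y1 by simp
        moreover have "inv\<^bsub>F2\<^esub> f2 \<otimes>\<^bsub>F2\<^esub> (h \<otimes>\<^bsub>F2\<^esub> g2) \<in> centralizer F2 x2"
          using g2 f hc gc by (simp add: F2.word_simps)
        then have "h \<otimes>\<^bsub>F2\<^esub> g2 \<otimes>\<^bsub>F2\<^esub> x2 \<otimes>\<^bsub>F2\<^esub> inv\<^bsub>F2\<^esub> (h \<otimes>\<^bsub>F2\<^esub> g2) = y2"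
          using F2.conj_eq_iff_centralizer[OF xc(2) f(2)] hc gc y2 by simp
        ultimately show False
          using nconj conjI'[OF Gm[OF h g(1)], of x1 x2] x y by simp
      qed
      obtain L1 L2 where L: "open_normal C F1 L1" "open_normal C F2 L2"
        and nL: "\<And>g1 g2. \<lbrakk>(g1, g2) \<in> G; g1 \<otimes>\<^bsub>F1\<^esub> x1 \<otimes>\<^bsub>F1\<^esub> inv\<^bsub>F1\<^esub> g1 \<otimes>\<^bsub>F1\<^esub> inv\<^bsub>F1\<^esub> x1 \<in> L1\<rbrakk> \<Longrightarrow>
          (inv\<^bsub>F2\<^esub> ?f \<otimes>\<^bsub>F2\<^esub> g2) \<otimes>\<^bsub>F2\<^esub> x2 \<otimes>\<^bsub>F2\<^esub> inv\<^bsub>F2\<^esub> (inv\<^bsub>F2\<^esub> ?f \<otimes>\<^bsub>F2\<^esub> g2) \<otimes>\<^bsub>F2\<^esub> inv\<^bsub>F2\<^esub> x2 \<notin> L2"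
        by (rule subdirect_product_separation[OF assms(1-4) C assms(5-11) xG x1_ne x2_ne fc nc], assumption+, rule that)
      let ?N = "{a \<in> carrier ?G. fst a \<in> L1} \<inter> {a \<in> carrier ?G. snd a \<in> L2}"
      have "open_normal C ?G ?N"
        using L fst_hom snd_hom GG
        by (intro open_normal_Int[OF assms(1)] open_normal_vimage[OF assms(1)])
      moreover have "g \<otimes>\<^bsub>?G\<^esub> x \<otimes>\<^bsub>?G\<^esub> inv\<^bsub>?G\<^esub> g \<otimes>\<^bsub>?G\<^esub> inv\<^bsub>?G\<^esub> y \<notin> ?N" if "g \<in> carrier ?G" for g
      proof
        obtain g1 g2 where g: "g = (g1, g2)"
          by fastforce
        then have gG: "(g1, g2) \<in> G"
          using that by simp
        note gc = Gc[OF gG]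
        assume "g \<otimes>\<^bsub>?G\<^esub> x \<otimes>\<^bsub>?G\<^esub> inv\<^bsub>?G\<^esub> g \<otimes>\<^bsub>?G\<^esub> inv\<^bsub>?G\<^esub> y \<in> ?N"
        then have g1: "g1 \<otimes>\<^bsub>F1\<^esub> x1 \<otimes>\<^bsub>F1\<^esub> inv\<^bsub>F1\<^esub> g1 \<otimes>\<^bsub>F1\<^esub> inv\<^bsub>F1\<^esub> y1 \<in> L1"
          and g2: "g2 \<otimes>\<^bsub>F2\<^esub> x2 \<otimes>\<^bsub>F2\<^esub> inv\<^bsub>F2\<^esub> g2 \<otimes>\<^bsub>F2\<^esub> inv\<^bsub>F2\<^esub> y2 \<in> L2"
          using gG xG yG by (simp_all add: g x y inv_pair)
        \<comment> \<open>Multiplying by the inverse of \<open>(f1, h)\<close> undoes the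
          normalization of \<open>y\<close>, and \<open>f_inv\<close> identifies the second
          coordinate that \<open>nL\<close> then speaks of.\<close>
        have "(inv\<^bsub>F1\<^esub> f1 \<otimes>\<^bsub>F1\<^esub> g1, inv\<^bsub>F2\<^esub> h \<otimes>\<^bsub>F2\<^esub> g2) \<in> G"
          by (intro Gm Gi h gG)
        from nL[OF this normal.conj_diff_mem[OF open_normal_normal[OF L(1)] xc(1) f(1) gc(1) g1[unfolded y1]]]
        show False
          using normal.conj_diff_mem[OF open_normal_normal[OF L(2)] xc(2) f(2) gc(2) g2[unfolded y2]]
          unfolding f_inv[OF gc(2)] by contradiction
      qed
      ultimately have "\<exists>N. open_normal C ?G N \<and>
          (\<forall>g\<in>carrier ?G. g \<otimes>\<^bsub>?G\<^esub> x \<otimes>\<^bsub>?G\<^esub> inv\<^bsub>?G\<^esub> g \<otimes>\<^bsub>?G\<^esub> inv\<^bsub>?G\<^esub> y \<notin> N)"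
        by blast
      then show ?thesis
        using separated_by_hom_iff_open_normal[OF assms(1) GG, of x y] xG yG x y by simp
    qed
  qed
qed

end
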